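(* For each dimension $d$, let $A=A_d\in M_{d\times d}$ be a random matrix and $\mathbf{x}_0=\mathbf{x}_{0,d}\in\mathbb{R}^d$ a random vector such that: (a) $A$ is sampled from a symmetric, real-valued random matrix ensemble, with $d$ distinct eigenvalues almost surely, whose probability measure $p(A)$ is invariant under orthogonal transformations: $p(A)=p(TAT')$ for all $T\in O(d)$ (i.e. $TAT'$ has the same distribution as $A$); (b) $\mathbf{x}_0$ is sampled from a random distribution that is independent of $A$ and satisfies $$\lim_{d\to\infty}\frac{E|\mathbf{x}_0|^2}{d^3}=0.$$ Then the ICIS $w_0^*(A,\mathbf{x}_0)$ converges to zero in $L^2$, namely $$E\left(w_0^*(A,\mathbf{x}_0)\right)^2\longrightarrow 0\qquad\text{when } d\to\infty.$$
   Context: $M_{d\times d}$ is the set of real $d\times d$ matrices, $'$ denotes transpose, $O(d)$ is the orthogonal group, and $|\cdot|$ is the Euclidean norm. ICIS (Initial Condition-based Identifiability Score) for a symmetric matrix: a real symmetric $A$ with $d$ distinct eigenvalues is written as $A=Q\Lambda Q'$ with $\Lambda$ real diagonal and $Q$ orthogonal (columns are orthonormal eigenvectors of $A$). Then $w_0^*(A,\mathbf{x}_0)=\min_{1\le i\le d}|(Q^{-1}\mathbf{x}_0)_i|=\min_{1\le i\le d}|(Q'\mathbf{x}_0)_i|$. (This does not depend on the choice of signs and ordering of the columns of $Q$.) *)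

theory Defs
  imports "HOL-Probability.Probability" "Jordan_Normal_Form.Spectral_Radius"
begin

unbundle no vec_syntax
unbundle no inner_syntax

text \<open>Since the dimension \<open>d\<close> varies inside the statement, real \<open>d \<times> d\<close> matrices and vectors of
  length \<open>d\<close> are the elements of \<^term>\<open>carrier_mat d d\<close> and \<^term>\<open>carrier_vec d\<close>. Their Borel
  structure is the one pulled back along the entries from the product Borel space.\<close>

definition mat_borel :: "nat \<Rightarrow> real mat measure" where
  "mat_borel d = vimage_algebra (carrier_mat d d)
     (\<lambda>A. \<lambda>ij\<in>{..<d} \<times> {..<d}. A $$ ij) (PiM ({..<d} \<times> {..<d}) (\<lambda>_. borel))"

definition vec_borel :: "nat \<Rightarrow> real vec measure" where
  "vec_borel d = vimage_algebra (carrier_vec d)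
     (\<lambda>x. \<lambda>i\<in>{..<d}. x $ i) (PiM {..<d} (\<lambda>_. borel))"

definition vec_norm2 :: "real vec \<Rightarrow> real" where
  "vec_norm2 x = L2_set (\<lambda>i. x $ i) {..<dim_vec x}"

text \<open>The constant \<^const>\<open>orthogonal_mat\<close> only asks for orthogonal nonzero columns, not for
  orthonormal ones, so it does not define the orthogonal group.\<close>

definition orthogonal_group :: "nat \<Rightarrow> real mat set" where
  "orthogonal_group d =
     {T \<in> carrier_mat d d. T\<^sup>T * T = 1\<^sub>m d \<and> T * T\<^sup>T = 1\<^sub>m d}"

definition orthogonally_diagonalizes :: "real mat \<Rightarrow> real mat \<Rightarrow> bool" where
  "orthogonally_diagonalizes Q A \<longleftrightarrow>
     Q \<in> orthogonal_group (dim_row A) \<and>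
     (\<exists>L \<in> carrier_mat (dim_row A) (dim_row A). diagonal_mat L \<and> A = Q * L * Q\<^sup>T)"

text \<open>For a symmetric \<open>A\<close> with \<open>dim_row A\<close> distinct eigenvalues, \<open>Q\<close> is unique up to signs and order
  of its columns, so the choice below does not affect the value. For other \<open>A\<close> the value carries
  no meaning.\<close>

definition icis :: "real mat \<Rightarrow> real vec \<Rightarrow> real" where
  "icis A x0 = (let Q = (SOME Q. orthogonally_diagonalizes Q A)
     in MIN i\<in>{..<dim_row A}. \<bar>(Q\<^sup>T *\<^sub>v x0) $ i\<bar>)"

text \<open>Independence of the generated \<open>\<sigma>\<close>-algebras. The constant \<^const>\<open>prob_space.indep_var\<close>
  cannot be used, as it requires both random variables to take values in the same type.\<close>

definition indep_rv :: "'w measure \<Rightarrow> 'a measure \<Rightarrow> ('w \<Rightarrow> 'a) \<Rightarrow> 'b measure \<Rightarrow> ('w \<Rightarrow> 'b) \<Rightarrow> bool" where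
  "indep_rv M S X T Y \<longleftrightarrow>
     X \<in> measurable M S \<and> Y \<in> measurable M T \<and>
     prob_space.indep_set M
       (sets (vimage_algebra (space M) X S)) (sets (vimage_algebra (space M) Y T))"

definition invariant_symmetric_ensemble :: "nat \<Rightarrow> 'w measure \<Rightarrow> ('w \<Rightarrow> real mat) \<Rightarrow> bool" where
  "invariant_symmetric_ensemble d M A \<longleftrightarrow>
     A \<in> measurable M (mat_borel d) \<and>
     (AE \<omega> in M. (A \<omega>)\<^sup>T = A \<omega>) \<and>
     (AE \<omega> in M. card (spectrum (A \<omega>)) = d) \<and>
     (\<forall>T \<in> orthogonal_group d.
        distr M (mat_borel d) (\<lambda>\<omega>. T * A \<omega> * T\<^sup>T) = distr M (mat_borel d) A)"

end

theory Submission
  imports Defs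
begin

text \<open>Write \<open>w(A, x)\<close> for the score and fix a vector \<open>x\<close>. Replacing \<open>(A, x)\<close> by
  \<open>(T A T', T x)\<close> with \<open>T\<close> orthogonal turns the eigenvectors of \<open>A\<close> by \<open>T\<close> and leaves \<open>w\<close>
  unchanged, so the invariance of the ensemble makes \<open>F(x) = E w(A, x)\<^sup>2\<close> a function of \<open>|x|\<close>
  alone. It is homogeneous of degree two, hence \<open>F(x) = c |x|\<^sup>2\<close>
  (\<open>expected_score_homogeneous\<close>). The constant \<open>c\<close> is found by integrating over a standard Gaussian
  vector \<open>g\<close>: on one side \<open>E F(g) = c d\<close>. On the other side, for a fixed matrix the coordinates of
  \<open>g\<close> in an orthonormal eigenbasis are again independent standard normal variables, so
  \<open>E\<^sub>g w(a, g)\<^sup>2\<close> is the second moment of the smallest absolute value among \<open>d\<close> independent standard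
  normal variables. Since \<open>P(|g\<^sub>i| \<ge> t) \<le> exp (- t sqrt (2/\<pi>))\<close>, that moment is at most
  \<open>\<pi>/d\<^sup>2\<close> (\<open>gauss_min_square\<close>), which gives \<open>c \<le> \<pi>/d\<^sup>3\<close> (\<open>expected_score_le\<close>). By independence
  \<open>E w(A, x\<^sub>0)\<^sup>2 \<le> \<pi> E|x\<^sub>0|\<^sup>2 / d\<^sup>3\<close>, and the theorem follows.

  The Gaussian average over \<open>x\<close> stands in for an average over the orthogonal group. The invariance
  behind it is that orthogonal maps preserve the \<open>d\<close>-fold product of Lebesgue measure
  (\<open>vec_lborel_orthogonal\<close>), which is derived from translation invariance.

  Exchanging the averages over \<open>A\<close> and over the vector requires joint measurability, whereas the
  eigenbasis in the definition of the score is an arbitrary choice. The argument is therefore run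
  with the infimum of \<open>(u \<bullet> x)\<^sup>2\<close> over all unit eigenvectors \<open>u\<close>, which equals the squared score when
  the matrix is symmetric with simple spectrum, and which is measurable because the unit sphere is compact
  (\<open>measurable_eigenvector_score\<close>).\<close>

section \<open>Borel structure of vectors and matrices\<close>

lemma space_vec_borel [simp]: "space (vec_borel d) = carrier_vec d"
  by (simp add: vec_borel_def)

lemma space_mat_borel [simp]: "space (mat_borel d) = carrier_mat d d"
  by (simp add: mat_borel_def)

lemma measurable_vec_borelI:
  assumes "\<And>\<omega>. \<omega> \<in> space N \<Longrightarrow> f \<omega> \<in> carrier_vec d"
    and "\<And>i. i < d \<Longrightarrow> (\<lambda>\<omega>. f \<omega> $ i) \<in> borel_measurable N"
  shows "f \<in> measurable N (vec_borel d)"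
  unfolding vec_borel_def
  by (intro measurable_vimage_algebra2 measurable_restrict) (use assms in auto)

lemma measurable_mat_borelI:
  assumes "\<And>\<omega>. \<omega> \<in> space N \<Longrightarrow> f \<omega> \<in> carrier_mat d d"
    and "\<And>i j. i < d \<Longrightarrow> j < d \<Longrightarrow> (\<lambda>\<omega>. f \<omega> $$ (i, j)) \<in> borel_measurable N"
  shows "f \<in> measurable N (mat_borel d)"
  unfolding mat_borel_def
  by (intro measurable_vimage_algebra2 measurable_restrict) (use assms in auto)

lemma measurable_vec_index [measurable (raw)]:
  assumes "f \<in> measurable N (vec_borel d)" and "i < d"
  shows "(\<lambda>\<omega>. f \<omega> $ i) \<in> borel_measurable N"
proof -
  have "(\<lambda>x. \<lambda>i\<in>{..<d}. x $ i) \<in> measurable (vec_borel d) (PiM {..<d} (\<lambda>_. borel :: real measure))"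
    unfolding vec_borel_def by (intro measurable_vimage_algebra1) (auto simp: space_PiM)
  from measurable_compose[OF this measurable_component_singleton, of i]
  have "(\<lambda>x. x $ i) \<in> borel_measurable (vec_borel d)"
    using \<open>i < d\<close> by simp
  from measurable_compose[OF assms(1) this] show ?thesis .
qed

lemma measurable_mat_index [measurable (raw)]:
  assumes "f \<in> measurable N (mat_borel d)" and "i < d" and "j < d"
  shows "(\<lambda>\<omega>. f \<omega> $$ (i, j)) \<in> borel_measurable N"
proof -
  have "(\<lambda>A. \<lambda>ij\<in>{..<d} \<times> {..<d}. A $$ ij)
      \<in> measurable (mat_borel d) (PiM ({..<d} \<times> {..<d}) (\<lambda>_. borel :: real measure))"
    unfolding mat_borel_def by (intro measurable_vimage_algebra1) (auto simp: space_PiM)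
  from measurable_compose[OF this measurable_component_singleton, of "(i, j)"]
  have "(\<lambda>A. A $$ (i, j)) \<in> borel_measurable (mat_borel d)"
    using assms(2,3) by simp
  from measurable_compose[OF assms(1) this] show ?thesis .
qed

lemma measurable_vec_carrier:
  "f \<in> measurable N (vec_borel d) \<Longrightarrow> \<omega> \<in> space N \<Longrightarrow> f \<omega> \<in> carrier_vec d"
  using measurable_space[of f N "vec_borel d" \<omega>] by simp

lemma measurable_mat_carrier:
  "f \<in> measurable N (mat_borel d) \<Longrightarrow> \<omega> \<in> space N \<Longrightarrow> f \<omega> \<in> carrier_mat d d"
  using measurable_space[of f N "mat_borel d" \<omega>] by simp

lemma scalar_prod_eq_sum: "g \<in> carrier_vec d \<Longrightarrow> f \<bullet> g = (\<Sum>i<d. f $ i * g $ i)"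
  by (auto simp: scalar_prod_def lessThan_atLeast0)

lemma mult_mat_vec_index:
  assumes "A \<in> carrier_mat n d" "x \<in> carrier_vec d" "i < n"
  shows "(A *\<^sub>v x) $ i = (\<Sum>j<d. A $$ (i, j) * x $ j)"
  using assms by (auto simp: scalar_prod_eq_sum[of x d] intro!: sum.cong)

lemma mult_mat_index:
  assumes "A \<in> carrier_mat n d" "B \<in> carrier_mat d m" "i < n" "k < m"
  shows "(A * B) $$ (i, k) = (\<Sum>j<d. A $$ (i, j) * B $$ (j, k))"
  using assms by (auto simp: scalar_prod_eq_sum[of _ d] intro!: sum.cong)

lemma measurable_scalar_prod [measurable (raw)]:
  assumes f: "f \<in> measurable N (vec_borel d)" and g: "g \<in> measurable N (vec_borel d)"
  shows "(\<lambda>\<omega>. f \<omega> \<bullet> g \<omega>) \<in> borel_measurable N"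
proof -
  have "(\<lambda>\<omega>. \<Sum>i<d. f \<omega> $ i * g \<omega> $ i) \<in> borel_measurable N"
    using f g by measurable
  then show ?thesis
    by (rule measurable_cong[THEN iffD1, rotated])
      (simp add: scalar_prod_eq_sum[OF measurable_vec_carrier[OF g]])
qed

lemma measurable_mult_mat_vec [measurable (raw)]:
  assumes A: "A \<in> measurable N (mat_borel d)" and f: "f \<in> measurable N (vec_borel d)"
  shows "(\<lambda>\<omega>. A \<omega> *\<^sub>v f \<omega>) \<in> measurable N (vec_borel d)"
proof (rule measurable_vec_borelI)
  fix i assume i: "i < d"
  have "(\<lambda>\<omega>. \<Sum>j<d. A \<omega> $$ (i, j) * f \<omega> $ j) \<in> borel_measurable N"
    using A f i by measurable
  then show "(\<lambda>\<omega>. (A \<omega> *\<^sub>v f \<omega>) $ i) \<in> borel_measurable N"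
    by (rule measurable_cong[THEN iffD1, rotated])
      (simp add: mult_mat_vec_index[OF measurable_mat_carrier[OF A] measurable_vec_carrier[OF f] i])
qed (rule mult_mat_vec_carrier[OF measurable_mat_carrier[OF A] measurable_vec_carrier[OF f]])

lemma measurable_mult_mat [measurable (raw)]:
  assumes A: "A \<in> measurable N (mat_borel d)" and B: "B \<in> measurable N (mat_borel d)"
  shows "(\<lambda>\<omega>. A \<omega> * B \<omega>) \<in> measurable N (mat_borel d)"
proof (rule measurable_mat_borelI)
  fix i k assume i: "i < d" "k < d"
  have "(\<lambda>\<omega>. \<Sum>j<d. A \<omega> $$ (i, j) * B \<omega> $$ (j, k)) \<in> borel_measurable N"
    using A B i by measurable
  then show "(\<lambda>\<omega>. (A \<omega> * B \<omega>) $$ (i, k)) \<in> borel_measurable N"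
    by (rule measurable_cong[THEN iffD1, rotated])
      (simp add: mult_mat_index[OF measurable_mat_carrier[OF A] measurable_mat_carrier[OF B] i])
qed (rule mult_carrier_mat[OF measurable_mat_carrier[OF A] measurable_mat_carrier[OF B]])

lemma measurable_vec_add [measurable (raw)]:
  assumes f: "f \<in> measurable N (vec_borel d)" and g: "g \<in> measurable N (vec_borel d)"
  shows "(\<lambda>\<omega>. f \<omega> + g \<omega>) \<in> measurable N (vec_borel d)"
proof (rule measurable_vec_borelI)
  fix i assume i: "i < d"
  have "(\<lambda>\<omega>. f \<omega> $ i + g \<omega> $ i) \<in> borel_measurable N"
    using f g i by measurable
  then show "(\<lambda>\<omega>. (f \<omega> + g \<omega>) $ i) \<in> borel_measurable N"
    by (rule measurable_cong[THEN iffD1, rotated])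
      (simp add: carrier_vecD[OF measurable_vec_carrier[OF g]] i)
qed (rule add_carrier_vec[OF measurable_vec_carrier[OF f] measurable_vec_carrier[OF g]])

lemma measurable_vec_uminus [measurable (raw)]:
  assumes f: "f \<in> measurable N (vec_borel d)"
  shows "(\<lambda>\<omega>. - f \<omega>) \<in> measurable N (vec_borel d)"
proof (rule measurable_vec_borelI)
  fix i assume i: "i < d"
  have "(\<lambda>\<omega>. - (f \<omega> $ i)) \<in> borel_measurable N"
    using f i by measurable
  then show "(\<lambda>\<omega>. (- f \<omega>) $ i) \<in> borel_measurable N"
    by (rule measurable_cong[THEN iffD1, rotated])
      (simp add: carrier_vecD[OF measurable_vec_carrier[OF f]] i)
qed (rule uminus_carrier_vec[THEN iffD2, OF measurable_vec_carrier[OF f]])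

section \<open>Lebesgue measure on vectors\<close>

definition vec_lborel :: "nat \<Rightarrow> real vec measure" where
  "vec_lborel d = distr (PiM {..<d} (\<lambda>_. lborel)) (vec_borel d) (vec d)"

lemma space_vec_lborel [simp]: "space (vec_lborel d) = carrier_vec d"
  and sets_vec_lborel [simp, measurable_cong]: "sets (vec_lborel d) = sets (vec_borel d)"
  by (simp_all add: vec_lborel_def)

interpretation lborel_product: product_sigma_finite "\<lambda>_::nat. lborel :: real measure"
  by standard

lemma measurable_vec [measurable]:
  "vec d \<in> measurable (PiM {..<d} (\<lambda>_. lborel)) (vec_borel d)"
  by (rule measurable_vec_borelI) auto

lemma nn_integral_vec_lborel:
  assumes [measurable]: "f \<in> borel_measurable (vec_borel d)"
  shows "(\<integral>\<^sup>+ x. f x \<partial>vec_lborel d) = (\<integral>\<^sup>+ x. f (vec d x) \<partial>PiM {..<d} (\<lambda>_. lborel))"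
  unfolding vec_lborel_def by (rule nn_integral_distr) auto

lemma nn_integral_vec_lborel_prod:
  assumes [measurable]: "\<And>i. i < d \<Longrightarrow> f i \<in> borel_measurable borel"
  shows "(\<integral>\<^sup>+ x. (\<Prod>i<d. f i (x $ i)) \<partial>vec_lborel d) = (\<Prod>i<d. \<integral>\<^sup>+ t. f i t \<partial>lborel)"
proof -
  have "(\<integral>\<^sup>+ x. (\<Prod>i<d. f i (x $ i)) \<partial>vec_lborel d)
      = (\<integral>\<^sup>+ x. (\<Prod>i<d. f i (x i)) \<partial>PiM {..<d} (\<lambda>_. lborel))"
    by (subst nn_integral_vec_lborel) auto
  also have "\<dots> = (\<Prod>i<d. \<integral>\<^sup>+ t. f i t \<partial>lborel)"
    by (rule lborel_product.product_nn_integral_prod) auto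
  finally show ?thesis .
qed

lemma sigma_finite_vec_lborel: "sigma_finite_measure (vec_lborel d)"
proof -
  define C where "C n = {x \<in> carrier_vec d. (\<Sum>i<d. \<bar>x $ i\<bar>) \<le> real n}" for n
  have C: "C n \<in> sets (vec_borel d)" for n
  proof -
    have "(\<lambda>x. \<Sum>i<d. \<bar>x $ i\<bar>) \<in> borel_measurable (vec_borel d)"
      by measurable
    from borel_measurable_le[OF this borel_measurable_const, of "real n"]
    show ?thesis by (simp add: C_def)
  qed
  have "emeasure (vec_lborel d) (C n) \<noteq> \<infinity>" for n
  proof -
    have "emeasure (vec_lborel d) (C n) = (\<integral>\<^sup>+ x. indicator (C n) x \<partial>vec_lborel d)"
      using C by simp
    also have "\<dots> \<le> (\<integral>\<^sup>+ x. (\<Prod>i<d. indicator {- real n..real n} (x $ i)) \<partial>vec_lborel d)"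
    proof (intro nn_integral_mono)
      fix x :: "real vec"
      show "indicator (C n) x \<le> (\<Prod>i<d. indicator {- real n..real n} (x $ i) :: ennreal)"
      proof (cases "x \<in> C n")
        case True
        have "x $ i \<in> {- real n..real n}" if "i < d" for i
          using True that member_le_sum[of i "{..<d}" "\<lambda>i. \<bar>x $ i\<bar>"]
          by (auto simp: C_def abs_le_iff)
        then have "(\<Prod>i<d. indicator {- real n..real n} (x $ i) :: ennreal) = 1"
          by (intro prod.neutral) (simp add: indicator_def)
        then show ?thesis using True by simp
      qed simp
    qed
    also have "\<dots> < \<infinity>"
      by (subst nn_integral_vec_lborel_prod) (auto simp: power_less_top_ennreal)
    finally show ?thesis by simp
  qed
  moreover have "(\<Union>n. C n) = carrier_vec d"
    using real_arch_simple by (fastforce simp: C_def)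
  ultimately show ?thesis
    using C by (intro sigma_finite_measure.intro exI[of _ "range C"]) auto
qed

lemma vec_lborel_translate:
  assumes v: "v \<in> carrier_vec d" and [measurable]: "f \<in> borel_measurable (vec_borel d)"
  shows "(\<integral>\<^sup>+ x. f (x + v) \<partial>vec_lborel d) = (\<integral>\<^sup>+ x. f x \<partial>vec_lborel d)"
proof -
  let ?P = "PiM {..<d} (\<lambda>_. lborel :: real measure)"
  define \<tau> where "\<tau> x = (\<lambda>i\<in>{..<d}. v $ i + x i)" for x :: "nat \<Rightarrow> real"
  have \<tau>[measurable]: "\<tau> \<in> measurable ?P ?P"
    unfolding \<tau>_def
  proof (rule measurable_restrict)
    fix i assume "i \<in> {..<d}"
    then have "(\<lambda>x. x i) \<in> borel_measurable ?P"
      using measurable_component_singleton[of i "{..<d}" "\<lambda>_. lborel :: real measure"] by simp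
    from borel_measurable_add[OF borel_measurable_const this]
    show "(\<lambda>x. v $ i + x i) \<in> measurable ?P lborel" by simp
  qed
  have distr: "distr ?P ?P \<tau> = ?P"
  proof (rule lborel_product.PiM_eqI)
    fix B :: "nat \<Rightarrow> real set" assume B: "\<And>i. i \<in> {..<d} \<Longrightarrow> B i \<in> sets lborel"
    have "emeasure (distr ?P ?P \<tau>) (Pi\<^sub>E {..<d} B) = emeasure ?P (\<tau> -` Pi\<^sub>E {..<d} B \<inter> space ?P)"
      using B by (intro emeasure_distr) (auto intro!: sets_PiM_I_finite)
    also have "\<tau> -` Pi\<^sub>E {..<d} B \<inter> space ?P = Pi\<^sub>E {..<d} (\<lambda>i. (+) (v $ i) -` B i)"
      by (auto simp: \<tau>_def space_PiM PiE_iff)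
    also have "emeasure ?P \<dots> = (\<Prod>i<d. emeasure lborel ((+) (v $ i) -` B i))"
    proof (intro lborel_product.emeasure_PiM)
      show "(+) (v $ i) -` B i \<in> sets lborel" if "i \<in> {..<d}" for i
        using measurable_sets[of "(+) (v $ i)" borel borel "B i"] B[OF that] by simp
    qed simp
    also have "\<dots> = (\<Prod>i<d. emeasure (distr lborel borel ((+) (v $ i))) (B i))"
      using B by (intro prod.cong) (auto simp: emeasure_distr)
    finally show "emeasure (distr ?P ?P \<tau>) (Pi\<^sub>E {..<d} B) = (\<Prod>i<d. emeasure lborel (B i))"
      by (simp add: lborel_distr_plus)
  qed auto
  have "(\<integral>\<^sup>+ x. f (vec d x) \<partial>?P) = (\<integral>\<^sup>+ x. f (vec d x) \<partial>distr ?P ?P \<tau>)"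
    by (simp only: distr)
  also have "\<dots> = (\<integral>\<^sup>+ x. f (vec d (\<tau> x)) \<partial>?P)"
    using measurable_compose[OF measurable_vec assms(2)] by (intro nn_integral_distr[OF \<tau>]) simp
  also have "\<dots> = (\<integral>\<^sup>+ x. f (vec d x + v) \<partial>?P)"
  proof (intro nn_integral_cong arg_cong[where f = f])
    show "vec d (\<tau> x) = vec d x + v" for x
      using v by (intro eq_vecI) (auto simp: \<tau>_def)
  qed
  finally show ?thesis
    using v by (subst (1 2) nn_integral_vec_lborel) (auto intro!: measurable_vec_add)
qed

section \<open>The orthogonal group\<close>

lemma orthogonal_groupD:
  assumes "T \<in> orthogonal_group d"
  shows "T \<in> carrier_mat d d" "T\<^sup>T \<in> carrier_mat d d" "T\<^sup>T * T = 1\<^sub>m d" "T * T\<^sup>T = 1\<^sub>m d"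
  using assms by (auto simp: orthogonal_group_def)

lemma orthogonal_group_transpose: "T \<in> orthogonal_group d \<Longrightarrow> T\<^sup>T \<in> orthogonal_group d"
  by (auto simp: orthogonal_group_def)

lemma orthogonal_group_inverse:
  assumes T: "T \<in> orthogonal_group d" and x: "x \<in> carrier_vec d"
  shows "T\<^sup>T *\<^sub>v (T *\<^sub>v x) = x" "T *\<^sub>v (T\<^sup>T *\<^sub>v x) = x"
  using assoc_mult_mat_vec[of "T\<^sup>T" d d T d x] assoc_mult_mat_vec[of T d d "T\<^sup>T" d x]
    orthogonal_groupD[OF T] x by simp_all

lemma transpose_scalar_prod:
  fixes x y :: "real vec"
  assumes "T \<in> carrier_mat d d" "x \<in> carrier_vec d" "y \<in> carrier_vec d"
  shows "(T *\<^sub>v x) \<bullet> y = x \<bullet> (T\<^sup>T *\<^sub>v y)"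
  using transpose_vec_mult_scalar[of "T\<^sup>T" d d y x] assms by simp

lemma orthogonal_group_scalar_prod:
  assumes T: "T \<in> orthogonal_group d" and x: "x \<in> carrier_vec d" and y: "y \<in> carrier_vec d"
  shows "(T *\<^sub>v x) \<bullet> (T *\<^sub>v y) = x \<bullet> y"
proof -
  have "(T *\<^sub>v x) \<bullet> (T *\<^sub>v y) = x \<bullet> (T\<^sup>T *\<^sub>v (T *\<^sub>v y))"
    using orthogonal_groupD(1)[OF T] x y by (intro transpose_scalar_prod) auto
  then show ?thesis by (simp only: orthogonal_group_inverse[OF T y])
qed

lemma scalar_prod_self_nonneg: "0 \<le> x \<bullet> (x :: real vec)"
  by (auto simp: scalar_prod_def intro: sum_nonneg)

lemma scalar_prod_self_eq_0:
  fixes x :: "real vec"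
  assumes "x \<in> carrier_vec d" "x \<bullet> x = 0"
  shows "x = 0\<^sub>v d"
  using assms by (intro eq_vecI) (auto simp: scalar_prod_eq_sum[of x d] sum_nonneg_eq_0_iff)

text \<open>This matrix is \<open>1 - 2 w w' / (w \<bullet> w)\<close>, the reflection in the hyperplane orthogonal to \<open>w\<close>, and a
  symmetric involution is orthogonal.\<close>

lemma householder_orthogonal:
  fixes w :: "real vec"
  assumes w: "w \<in> carrier_vec d" and w0: "w \<bullet> w \<noteq> 0"
  shows "mat d d (\<lambda>(i, j). (if i = j then 1 else 0) - 2 / (w \<bullet> w) * w $ i * w $ j) \<in> orthogonal_group d"
    (is "?H \<in> _")
proof -
  define c where "c = 2 / (w \<bullet> w)"
  have ww: "(\<Sum>k<d. w $ k * w $ k) = w \<bullet> w"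
    using w by (simp add: scalar_prod_eq_sum)
  have c: "c * c * (w \<bullet> w) = 2 * c"
    using w0 by (simp add: c_def)
  have HH: "?H * ?H = 1\<^sub>m d"
  proof (intro eq_matI)
    fix i j assume ij: "i < dim_row (1\<^sub>m d :: real mat)" "j < dim_col (1\<^sub>m d :: real mat)"
    have "(?H * ?H) $$ (i, j) = (\<Sum>k<d. ((if i = k then 1 else 0) - c * w $ i * w $ k) *
        ((if k = j then 1 else 0) - c * w $ k * w $ j))"
      using ij by (subst mult_mat_index[of _ d d _ d]) (auto simp: c_def)
    also have "\<dots> = (\<Sum>k<d. (if k = i then (if i = j then 1 else 0) - c * w $ i * w $ j else 0)
        - (if k = j then c * w $ i * w $ j else 0) + c * c * w $ i * w $ j * (w $ k * w $ k))"
      by (intro sum.cong) (auto simp: algebra_simps)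
    also have "\<dots> = (if i = j then 1 else 0) - 2 * c * w $ i * w $ j
        + (c * c * (w \<bullet> w)) * w $ i * w $ j"
      using ij by (simp add: sum.distrib sum_subtractf ww flip: sum_distrib_left)
    finally show "(?H * ?H) $$ (i, j) = 1\<^sub>m d $$ (i, j)"
      using ij c by simp
  qed auto
  have "?H\<^sup>T = ?H"
    by (intro eq_matI) auto
  with HH show ?thesis by (auto simp: orthogonal_group_def)
qed

text \<open>The reflection along \<open>w = x - y\<close> exchanges \<open>x\<close> and \<open>y\<close>: equality of the norms gives
  \<open>w \<bullet> w = 2 (w \<bullet> x)\<close>, so that it maps \<open>x\<close> to \<open>x - w\<close>.\<close>

lemma orthogonal_group_transitive:
  fixes x y :: "real vec"
  assumes x: "x \<in> carrier_vec d" and y: "y \<in> carrier_vec d" and xy: "x \<bullet> x = y \<bullet> y"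
  shows "\<exists>T \<in> orthogonal_group d. T *\<^sub>v x = y"
proof (cases "x = y")
  case True
  then show ?thesis
    using x by (intro bexI[of _ "1\<^sub>m d"]) (auto simp: orthogonal_group_def)
next
  case False
  define w where "w = x - y"
  have w: "w \<in> carrier_vec d" using x y by (simp add: w_def)
  have w0: "w \<bullet> w \<noteq> 0"
  proof
    assume "w \<bullet> w = 0"
    from scalar_prod_self_eq_0[OF w this] have "x = y"
      using x y by (auto simp: w_def vec_eq_iff)
    with False show False ..
  qed
  let ?H = "mat d d (\<lambda>(i, j). (if i = j then 1 else 0) - 2 / (w \<bullet> w) * w $ i * w $ j)"
  have "w \<bullet> w = 2 * (w \<bullet> x)"
    using x y w xy comm_scalar_prod[OF x y]
    by (simp add: w_def minus_scalar_prod_distrib[of _ d] scalar_prod_minus_distrib[of _ d])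
  then have wx: "2 / (w \<bullet> w) * (w \<bullet> x) = 1"
    using w0 by (simp add: field_simps)
  have "?H *\<^sub>v x = y"
  proof (intro eq_vecI)
    fix i assume "i < dim_vec y"
    then have i: "i < d" using y by simp
    have "(?H *\<^sub>v x) $ i = (\<Sum>j<d. ((if i = j then 1 else 0) - 2 / (w \<bullet> w) * w $ i * w $ j) * x $ j)"
      using x i by (subst mult_mat_vec_index[of _ d d]) auto
    also have "\<dots> = (\<Sum>j<d. (if j = i then x $ i else 0) - (2 / (w \<bullet> w) * w $ i) * (w $ j * x $ j))"
      by (intro sum.cong) (auto simp: algebra_simps)
    also have "\<dots> = x $ i - (2 / (w \<bullet> w) * w $ i) * (w \<bullet> x)"
      using i by (simp only: sum_subtractf scalar_prod_eq_sum[OF x] sum_distrib_left[symmetric]) simp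
    also have "\<dots> = x $ i - w $ i * (2 / (w \<bullet> w) * (w \<bullet> x))" by simp
    also have "\<dots> = y $ i" unfolding wx using i x y by (simp add: w_def)
    finally show "(?H *\<^sub>v x) $ i = y $ i" .
  qed (use y in auto)
  with householder_orthogonal[OF w w0] show ?thesis by blast
qed

section \<open>The standard Gaussian density\<close>

definition gauss_density :: "nat \<Rightarrow> real vec \<Rightarrow> ennreal" where
  "gauss_density d x = (\<Prod>i<d. ennreal (std_normal_density (x $ i)))"

lemma measurable_gauss_density [measurable]: "gauss_density d \<in> borel_measurable (vec_borel d)"
  unfolding gauss_density_def by measurable

text \<open>The Gaussian is the density that is both a product over the coordinates and a function of the
  norm. The product form makes its integrals computable, the radial form makes it invariant under
  orthogonal maps.\<close>

lemma gauss_density_eq: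
  assumes "x \<in> carrier_vec d"
  shows "gauss_density d x = ennreal ((1 / sqrt (2 * pi)) ^ d * exp (- (x \<bullet> x) / 2))"
proof -
  have "gauss_density d x = ennreal (\<Prod>i<d. 1 / sqrt (2 * pi) * exp (- (x $ i)\<^sup>2 / 2))"
    unfolding gauss_density_def std_normal_density_def by (rule prod_ennreal) simp
  also have "(\<Prod>i<d. 1 / sqrt (2 * pi) * exp (- (x $ i)\<^sup>2 / 2))
      = (1 / sqrt (2 * pi)) ^ d * (\<Prod>i<d. exp (- (x $ i)\<^sup>2 / 2))"
    by (simp add: prod.distrib prod_dividef power_one_over)
  also have "(\<Prod>i<d. exp (- (x $ i)\<^sup>2 / 2)) = exp (- (x \<bullet> x) / 2)"
    using assms by (simp add: scalar_prod_eq_sum exp_sum[symmetric] power2_eq_square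
        sum_negf sum_divide_distrib)
  finally show ?thesis .
qed

lemma gauss_density_orthogonal:
  assumes "T \<in> orthogonal_group d" "x \<in> carrier_vec d"
  shows "gauss_density d (T *\<^sub>v x) = gauss_density d x"
  using assms orthogonal_groupD(1)[OF assms(1)]
  by (simp add: gauss_density_eq orthogonal_group_scalar_prod)

lemma gauss_density_uminus:
  assumes "x \<in> carrier_vec d"
  shows "gauss_density d (- x) = gauss_density d x"
  using assms unfolding gauss_density_def std_normal_density_def
  by (intro prod.cong) auto

lemma nn_integral_std_normal_density: "(\<integral>\<^sup>+ t. ennreal (std_normal_density t) \<partial>lborel) = 1"
  using prob_space.emeasure_space_1[OF prob_space_normal_density[of 1 0]]
  by (simp add: emeasure_density)

lemma nn_integral_gauss_density: "(\<integral>\<^sup>+ x. gauss_density d x \<partial>vec_lborel d) = 1"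
  unfolding gauss_density_def
  by (subst nn_integral_vec_lborel_prod) (auto simp: nn_integral_std_normal_density)

text \<open>This is the uniqueness argument for Haar measure, applied to the image of Lebesgue measure under
  \<open>T\<close>. Multiply the left-hand side by the total mass of the Gaussian \<open>g\<close>, shift \<open>x\<close> by \<open>T' y\<close>, exchange
  the integrals, and shift \<open>y\<close> by \<open>- T x\<close>; this moves \<open>f\<close> into the outer integral over \<open>y\<close>, with
  weight \<open>\<integral> g (T x - y) dx\<close>. As \<open>g\<close> is radial, \<open>g (T x - y) = g (x - T' y)\<close>, and one more shift shows
  that the weight is 1.\<close>

lemma vec_lborel_orthogonal:
  assumes T: "T \<in> orthogonal_group d" and f: "f \<in> borel_measurable (vec_borel d)"
  shows "(\<integral>\<^sup>+ x. f (T *\<^sub>v x) \<partial>vec_lborel d) = (\<integral>\<^sup>+ x. f x \<partial>vec_lborel d)"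
proof -
  let ?L = "vec_lborel d" and ?g = "gauss_density d"
  interpret sigma_finite_measure ?L by (rule sigma_finite_vec_lborel)
  interpret pair_sigma_finite ?L ?L ..
  note TC = orthogonal_groupD(1,2)[OF T]
  have Tm: "(\<lambda>\<omega>. T *\<^sub>v h \<omega>) \<in> measurable N (vec_borel d)"
    if "h \<in> measurable N (vec_borel d)" for h and N :: "'b measure"
    using that TC by (intro measurable_mult_mat_vec) auto
  have m_fst: "fst \<in> measurable (?L \<Otimes>\<^sub>M ?L) (vec_borel d)"
    and m_snd: "snd \<in> measurable (?L \<Otimes>\<^sub>M ?L) (vec_borel d)"
    using measurable_fst[of ?L ?L] measurable_snd[of ?L ?L]
    by (simp_all cong: measurable_cong_sets)
  have m_ident: "(\<lambda>x. x) \<in> measurable ?L (vec_borel d)"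
    by (simp cong: measurable_cong_sets)
  have m_const: "(\<lambda>x. v) \<in> measurable ?L (vec_borel d)" if "v \<in> carrier_vec d" for v
    using that by simp
  note f' = measurable_compose[OF _ f] and g' = measurable_compose[OF _ measurable_gauss_density]
  have "(\<integral>\<^sup>+ x. f (T *\<^sub>v x) \<partial>?L) = (\<integral>\<^sup>+ x. f (T *\<^sub>v x) \<partial>?L) * (\<integral>\<^sup>+ y. ?g y \<partial>?L)"
    by (simp add: nn_integral_gauss_density)
  also have "\<dots> = (\<integral>\<^sup>+ y. (\<integral>\<^sup>+ x. f (T *\<^sub>v x) \<partial>?L) * ?g y \<partial>?L)"
    by (rule nn_integral_cmult[symmetric]) simp
  also have "\<dots> = (\<integral>\<^sup>+ y. \<integral>\<^sup>+ x. f (T *\<^sub>v x + y) * ?g y \<partial>?L \<partial>?L)"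
  proof (rule nn_integral_cong)
    fix y assume "y \<in> space ?L"
    then have y: "y \<in> carrier_vec d" by simp
    \<comment> \<open>Shift \<open>x\<close> by \<open>T' y\<close>.\<close>
    have "(\<integral>\<^sup>+ x. f (T *\<^sub>v x) \<partial>?L) = (\<integral>\<^sup>+ x. f (T *\<^sub>v (x + T\<^sup>T *\<^sub>v y)) \<partial>?L)"
      using TC y by (intro vec_lborel_translate[symmetric] f' Tm) auto
    also have "\<dots> = (\<integral>\<^sup>+ x. f (T *\<^sub>v x + y) \<partial>?L)"
      using TC y by (intro nn_integral_cong)
        (simp add: mult_add_distrib_mat_vec[of T d d] orthogonal_group_inverse[OF T])
    also have "\<dots> * ?g y = (\<integral>\<^sup>+ x. f (T *\<^sub>v x + y) * ?g y \<partial>?L)"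
      using y by (intro nn_integral_multc[symmetric] f' measurable_vec_add Tm m_ident m_const)
    finally show "(\<integral>\<^sup>+ x. f (T *\<^sub>v x) \<partial>?L) * ?g y = (\<integral>\<^sup>+ x. f (T *\<^sub>v x + y) * ?g y \<partial>?L)" .
  qed
  also have "\<dots> = (\<integral>\<^sup>+ x. \<integral>\<^sup>+ y. f (T *\<^sub>v x + y) * ?g y \<partial>?L \<partial>?L)"
    unfolding split_beta'
    by (intro Fubini', unfold split_beta')
      (intro borel_measurable_times_ennreal f' g' measurable_vec_add Tm m_fst m_snd)
  also have "\<dots> = (\<integral>\<^sup>+ x. \<integral>\<^sup>+ y. f y * ?g (T *\<^sub>v x + - y) \<partial>?L \<partial>?L)"
  proof (rule nn_integral_cong)
    fix x assume "x \<in> space ?L"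
    then have x: "T *\<^sub>v x \<in> carrier_vec d" using TC by simp
    have "(\<integral>\<^sup>+ y. f (T *\<^sub>v x + y) * ?g y \<partial>?L)
        = (\<integral>\<^sup>+ y. f (T *\<^sub>v x + (y + - (T *\<^sub>v x))) * ?g (y + - (T *\<^sub>v x)) \<partial>?L)"
      using x by (intro vec_lborel_translate[symmetric] borel_measurable_times_ennreal f' g'
          measurable_vec_add measurable_ident) auto
    also have "\<dots> = (\<integral>\<^sup>+ y. f y * ?g (T *\<^sub>v x + - y) \<partial>?L)"
    proof (rule nn_integral_cong)
      fix y assume "y \<in> space ?L"
      then have y: "y \<in> carrier_vec d" by simp
      have *: "v + (y + - v) = y" "y + - v = - (v + - y)" if "v \<in> carrier_vec d" for v :: "real vec"
        using that y by auto
      show "f (T *\<^sub>v x + (y + - (T *\<^sub>v x))) * ?g (y + - (T *\<^sub>v x)) = f y * ?g (T *\<^sub>v x + - y)"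
        using x y gauss_density_uminus[of "T *\<^sub>v x + - y" d] unfolding *(1)[OF x] unfolding *(2)[OF x] by simp
    qed
    finally show "(\<integral>\<^sup>+ y. f (T *\<^sub>v x + y) * ?g y \<partial>?L) = (\<integral>\<^sup>+ y. f y * ?g (T *\<^sub>v x + - y) \<partial>?L)" .
  qed
  also have "\<dots> = (\<integral>\<^sup>+ y. \<integral>\<^sup>+ x. f y * ?g (T *\<^sub>v x + - y) \<partial>?L \<partial>?L)"
    by (intro Fubini'[symmetric], unfold split_beta')
      (intro borel_measurable_times_ennreal f' g' measurable_vec_add measurable_vec_uminus Tm m_fst m_snd)
  also have "\<dots> = (\<integral>\<^sup>+ y. f y \<partial>?L)"
  proof (rule nn_integral_cong)
    fix y assume "y \<in> space ?L"
    then have y: "y \<in> carrier_vec d" by simp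
    have y': "- (T\<^sup>T *\<^sub>v y) \<in> carrier_vec d" using y TC by simp
    have "(\<integral>\<^sup>+ x. f y * ?g (T *\<^sub>v x + - y) \<partial>?L) = f y * (\<integral>\<^sup>+ x. ?g (T *\<^sub>v x + - y) \<partial>?L)"
      using y by (intro nn_integral_cmult g' measurable_vec_add Tm m_ident m_const) auto
    also have "(\<integral>\<^sup>+ x. ?g (T *\<^sub>v x + - y) \<partial>?L) = (\<integral>\<^sup>+ x. ?g (x + - (T\<^sup>T *\<^sub>v y)) \<partial>?L)"
    proof (rule nn_integral_cong)
      fix x assume "x \<in> space ?L"
      then have x: "x \<in> carrier_vec d" by simp
      have "T *\<^sub>v ((-1) \<cdot>\<^sub>v (T\<^sup>T *\<^sub>v y)) = (-1) \<cdot>\<^sub>v y"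
        using y TC mult_mat_vec[of T d d "T\<^sup>T *\<^sub>v y" "-1"] orthogonal_group_inverse[OF T y]
        by simp
      moreover have "(-1) \<cdot>\<^sub>v v = - v" for v :: "real vec"
        by auto
      ultimately have "T *\<^sub>v x + - y = T *\<^sub>v (x + - (T\<^sup>T *\<^sub>v y))"
        using x y' TC by (simp add: mult_add_distrib_mat_vec[of T d d])
      then show "?g (T *\<^sub>v x + - y) = ?g (x + - (T\<^sup>T *\<^sub>v y))"
        using x y' gauss_density_orthogonal[OF T, of "x + - (T\<^sup>T *\<^sub>v y)"] by simp
    qed
    also have "\<dots> = (\<integral>\<^sup>+ x. ?g x \<partial>?L)"
      by (rule vec_lborel_translate[OF y']) simp
    finally show "(\<integral>\<^sup>+ x. f y * ?g (T *\<^sub>v x + - y) \<partial>?L) = f y"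
      by (simp add: nn_integral_gauss_density)
  qed
  finally show ?thesis .
qed

section \<open>Small coordinates of a Gaussian vector\<close>

text \<open>The comparison density \<open>c/2 exp (- c |x|)\<close> has an exactly exponential tail, with no prefactor.
  A prefactor above 1 would be fatal in \<open>gauss_min_square\<close>, where the tail is raised to the power \<open>d\<close>.\<close>

lemma nn_integral_laplace_tail:
  fixes c t :: real
  assumes c: "0 < c" and t: "0 \<le> t"
  shows "(\<integral>\<^sup>+ x. ennreal (c / 2 * exp (- c * \<bar>x\<bar>)) * indicator {x. t \<le> \<bar>x\<bar>} x \<partial>lborel)
    = ennreal (exp (- c * t))"
proof -
  let ?h = "\<lambda>x. ennreal (c / 2 * exp (- c * x)) * indicator {t..} x"
  have half: "(\<integral>\<^sup>+ x. ?h x \<partial>lborel) = ennreal (exp (- c * t) / 2)"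
  proof (subst nn_integral_FTC_atLeast)
    show "((\<lambda>x. - exp (- c * x) / 2) has_real_derivative c / 2 * exp (- c * x)) (at x)" for x
      using c by (auto intro!: derivative_eq_intros)
    have "LIM x at_top. - c * x :> at_bot"
      using c by (intro filterlim_tendsto_neg_mult_at_bot[OF tendsto_const _ filterlim_ident]) auto
    then have "((\<lambda>x. exp (- c * x)) \<longlongrightarrow> 0) at_top"
      by (rule filterlim_compose[OF exp_at_bot])
    then have "((\<lambda>x. - exp (- c * x) / 2) \<longlongrightarrow> - 0 / 2) at_top"
      by (intro tendsto_intros) auto
    then show "((\<lambda>x. - exp (- c * x) / 2) \<longlongrightarrow> 0) at_top" by simp
  qed (use c in auto)
  have "(\<integral>\<^sup>+ x. ennreal (c / 2 * exp (- c * \<bar>x\<bar>)) * indicator {x. t \<le> \<bar>x\<bar>} x \<partial>lborel)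
      = (\<integral>\<^sup>+ x. ?h x + ?h (- x) \<partial>lborel)"
  proof (rule nn_integral_cong_AE, rule AE_mp[OF AE_lborel_singleton[of 0]], intro AE_I2 impI)
    fix x :: real assume "x \<noteq> 0"
    then consider "x > 0" | "x < 0" by linarith
    then show "ennreal (c / 2 * exp (- c * \<bar>x\<bar>)) * indicator {x. t \<le> \<bar>x\<bar>} x = ?h x + ?h (- x)"
      using t by cases (simp_all add: indicator_def)
  qed
  also have "\<dots> = (\<integral>\<^sup>+ x. ?h x \<partial>lborel) + (\<integral>\<^sup>+ x. ?h (- x) \<partial>lborel)"
    by (rule nn_integral_add) auto
  also have "(\<integral>\<^sup>+ x. ?h (- x) \<partial>lborel) = (\<integral>\<^sup>+ x. ?h x \<partial>lborel)"
    using nn_integral_real_affine[of ?h "-1" 0] by simp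
  finally show ?thesis
    unfolding half by (subst (asm) ennreal_plus[symmetric]) auto
qed

text \<open>With \<open>c = sqrt (2/\<pi>)\<close> the normal density \<open>c/2 exp (- x\<^sup>2/2)\<close> and the Laplace density
  \<open>c/2 exp (- c |x|)\<close> agree at the origin. The normal density is the larger one for \<open>|x| \<le> 2 c\<close> and the
  smaller one beyond, and both have total mass 1, so the normal tail is dominated at every level.\<close>

lemma std_normal_tail_le:
  assumes t: "0 \<le> t"
  shows "(\<integral>\<^sup>+ x. ennreal (std_normal_density x) * indicator {x. t \<le> \<bar>x\<bar>} x \<partial>lborel)
    \<le> ennreal (exp (- sqrt (2 / pi) * t))"
proof -
  define c where "c = sqrt (2 / pi)"
  have c: "c > 0" by (simp add: c_def)
  define L where "L x = c / 2 * exp (- c * \<bar>x\<bar>)" for x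
  have [measurable]: "L \<in> borel_measurable borel" unfolding L_def by measurable
  have c_half: "1 / sqrt (2 * pi) = c / 2"
    by (simp add: c_def real_sqrt_mult real_sqrt_divide field_simps)
  have normal: "std_normal_density x = c / 2 * exp (- x\<^sup>2 / 2)" for x
    unfolding std_normal_density_def c_half ..
  have split: "(\<integral>\<^sup>+ x. ennreal (f x) \<partial>lborel) =
      (\<integral>\<^sup>+ x. ennreal (f x) * indicator {x. t \<le> \<bar>x\<bar>} x \<partial>lborel)
      + (\<integral>\<^sup>+ x. ennreal (f x) * indicator {x. \<bar>x\<bar> < t} x \<partial>lborel)"
    if [measurable]: "f \<in> borel_measurable borel" for f :: "real \<Rightarrow> real"
    by (subst nn_integral_add[symmetric]) (auto intro!: nn_integral_cong simp: indicator_def)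
  show ?thesis unfolding c_def[symmetric]
  proof (cases "t \<le> 2 * c")
    case True
    \<comment> \<open>Below \<open>t\<close> the normal density has the larger mass, so above \<open>t\<close> it has the smaller one.\<close>
    have le: "L x \<le> std_normal_density x" if "\<bar>x\<bar> < t" for x
    proof -
      have "\<bar>x\<bar> * \<bar>x\<bar> \<le> (2 * c) * \<bar>x\<bar>"
        using that True by (intro mult_right_mono) auto
      then show ?thesis
        using c by (simp add: L_def normal power2_eq_square)
    qed
    let ?NT = "\<integral>\<^sup>+ x. ennreal (std_normal_density x) * indicator {x. t \<le> \<bar>x\<bar>} x \<partial>lborel"
    let ?NC = "\<integral>\<^sup>+ x. ennreal (std_normal_density x) * indicator {x. \<bar>x\<bar> < t} x \<partial>lborel"
    let ?LT = "\<integral>\<^sup>+ x. ennreal (L x) * indicator {x. t \<le> \<bar>x\<bar>} x \<partial>lborel"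
    let ?LC = "\<integral>\<^sup>+ x. ennreal (L x) * indicator {x. \<bar>x\<bar> < t} x \<partial>lborel"
    have N: "?NT + ?NC = 1"
      using split[of std_normal_density] by (simp add: nn_integral_std_normal_density)
    have "(\<integral>\<^sup>+ x. ennreal (L x) \<partial>lborel) = 1"
      using nn_integral_laplace_tail[OF c, of 0] by (simp add: L_def)
    then have L: "?LT + ?LC = 1"
      using split[of L] by simp
    have "?LC \<le> ?NC"
      using le by (intro nn_integral_mono) (auto simp: indicator_def intro!: ennreal_leI)
    then have "?NT + ?LC \<le> ?NT + ?NC" by (intro add_left_mono)
    also have "\<dots> = ?LT + ?LC" by (simp only: N L)
    finally have "?LC + ?NT \<le> ?LC + ?LT" by (simp only: add.commute)
    moreover have "?LC \<noteq> \<infinity>"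
      using L by (metis ennreal_add_eq_top ennreal_one_neq_top infinity_ennreal_def)
    ultimately have "?NT \<le> ?LT" by (simp add: ennreal_add_left_cancel_le)
    also have "?LT = ennreal (exp (- c * t))"
      unfolding L_def by (rule nn_integral_laplace_tail[OF c t])
    finally show "?NT \<le> ennreal (exp (- c * t))" .
  next
    case False
    have le: "std_normal_density x \<le> L x" if "t \<le> \<bar>x\<bar>" for x
    proof -
      have "(2 * c) * \<bar>x\<bar> \<le> \<bar>x\<bar> * \<bar>x\<bar>"
        using that False by (intro mult_right_mono) auto
      then show ?thesis
        using c by (simp add: L_def normal power2_eq_square)
    qed
    then have "(\<integral>\<^sup>+ x. ennreal (std_normal_density x) * indicator {x. t \<le> \<bar>x\<bar>} x \<partial>lborel)
      \<le> (\<integral>\<^sup>+ x. ennreal (L x) * indicator {x. t \<le> \<bar>x\<bar>} x \<partial>lborel)"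
      by (intro nn_integral_mono) (auto simp: indicator_def intro!: ennreal_leI)
    also have "\<dots> = ennreal (exp (- c * t))"
      unfolding L_def by (rule nn_integral_laplace_tail[OF c t])
    finally show "(\<integral>\<^sup>+ x. ennreal (std_normal_density x) * indicator {x. t \<le> \<bar>x\<bar>} x \<partial>lborel)
      \<le> ennreal (exp (- c * t))" .
  qed
qed

lemma nn_integral_two_exp:
  fixes a :: real
  assumes a: "0 < a"
  shows "(\<integral>\<^sup>+ t. ennreal (2 * t * exp (- a * t)) * indicator {0..} t \<partial>lborel) = ennreal (2 / a\<^sup>2)"
proof -
  have "(\<integral>\<^sup>+ t. ennreal (2 * t * exp (- a * t)) * indicator {0..} t \<partial>lborel)
      = (\<integral>\<^sup>+ t. ennreal (2 / a) * ennreal (erlang_density 0 a t * t ^ 1) \<partial>lborel)"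
    using a by (intro nn_integral_cong)
      (auto simp: erlang_density_def indicator_def ennreal_mult'[symmetric])
  also have "\<dots> = ennreal (2 / a) * ennreal (1 / a)"
    using nn_integral_erlang_ith_moment[OF a, of 0 1] a
    by (subst nn_integral_cmult) (auto simp: divide_ennreal[symmetric])
  also have "\<dots> = ennreal (2 / a\<^sup>2)"
    using a by (simp add: ennreal_mult'[symmetric] power2_eq_square)
  finally show ?thesis .
qed

text \<open>The layer cake formula for a square, in the form needed to integrate a squared minimum: the event
  \<open>t \<le> m\<close> for a minimum \<open>m\<close> is a product of one event per coordinate.\<close>

lemma square_eq_nn_integral:
  assumes "0 \<le> m"
  shows "ennreal (m\<^sup>2) = (\<integral>\<^sup>+ t. ennreal (2 * t) * indicator {0..m} t \<partial>lborel)"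
  using assms by (subst nn_integral_FTC_Icc[where F = "\<lambda>t. t\<^sup>2"])
    (auto intro!: derivative_eq_intros)

text \<open>By the layer cake formula and Fubini the left-hand side is \<open>\<integral> 2 t p(t)\<^sup>d dt\<close> over \<open>t \<ge> 0\<close>, where
  \<open>p(t)\<close> is the two-sided normal tail. The exponential bound on \<open>p\<close> turns this into
  \<open>\<integral> 2 t exp (- d c t) dt = 2 / (d c)\<^sup>2\<close> with \<open>c\<^sup>2 = 2/\<pi>\<close>.\<close>

lemma gauss_min_square:
  assumes d: "d \<ge> 1"
  shows "(\<integral>\<^sup>+ x. ennreal ((MIN i\<in>{..<d}. \<bar>x $ i\<bar>)\<^sup>2) * gauss_density d x \<partial>vec_lborel d)
    \<le> ennreal (pi / (real d)\<^sup>2)"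
proof -
  let ?L = "vec_lborel d" and ?g = "gauss_density d"
  interpret L: sigma_finite_measure ?L by (rule sigma_finite_vec_lborel)
  interpret pair_sigma_finite ?L lborel ..
  define c where "c = sqrt (2 / pi)"
  have c: "c > 0" "c\<^sup>2 = 2 / pi" by (simp_all add: c_def)
  define p where "p t = (\<lambda>s. ennreal (std_normal_density s) * indicator {s. t \<le> \<bar>s\<bar>} s)" for t :: real
  define h where "h x t = ennreal (2 * t) * indicator {0..} t *
      (\<Prod>i<d. ennreal (std_normal_density (x $ i)) * (if t \<le> \<bar>x $ i\<bar> then 1 else 0))" for x t
  have ne: "{..<d} \<noteq> {}" using d by (simp add: lessThan_empty_iff)
  have h: "(\<lambda>(x, t). h x t) \<in> borel_measurable (?L \<Otimes>\<^sub>M lborel)"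
  proof -
    have f: "fst \<in> measurable (?L \<Otimes>\<^sub>M lborel) (vec_borel d)"
      using measurable_fst[of ?L lborel] by (simp cong: measurable_cong_sets)
    have [measurable]: "(\<lambda>z. fst z $ i) \<in> borel_measurable (?L \<Otimes>\<^sub>M lborel)" if "i < d" for i
      by (rule measurable_vec_index[OF f that])
    show ?thesis unfolding h_def split_beta' by measurable
  qed
  have "(\<integral>\<^sup>+ x. ennreal ((MIN i\<in>{..<d}. \<bar>x $ i\<bar>)\<^sup>2) * ?g x \<partial>?L) = (\<integral>\<^sup>+ x. \<integral>\<^sup>+ t. h x t \<partial>lborel \<partial>?L)"
  proof (rule nn_integral_cong)
    fix x :: "real vec"
    let ?m = "MIN i\<in>{..<d}. \<bar>x $ i\<bar>"
    have m: "0 \<le> ?m" using ne by simp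
    have "h x t = ?g x * (ennreal (2 * t) * indicator {0..?m} t)" for t
    proof -
      have "(\<Prod>i<d. (if t \<le> \<bar>x $ i\<bar> then 1 else 0 :: ennreal)) = (if t \<le> ?m then 1 else 0)"
      proof -
        have "t \<le> ?m \<longleftrightarrow> (\<forall>i<d. t \<le> \<bar>x $ i\<bar>)" using ne by (subst Min_ge_iff) auto
        then show ?thesis by (auto intro!: prod_zero)
      qed
      then show ?thesis
        by (auto simp: h_def gauss_density_def prod.distrib indicator_def mult_ac)
    qed
    then show "ennreal (?m\<^sup>2) * ?g x = (\<integral>\<^sup>+ t. h x t \<partial>lborel)"
      by (simp add: nn_integral_cmult square_eq_nn_integral[OF m] mult.commute)
  qed
  also have "\<dots> = (\<integral>\<^sup>+ t. \<integral>\<^sup>+ x. h x t \<partial>?L \<partial>lborel)"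
    by (rule Fubini'[OF h, symmetric])
  also have "\<dots> = (\<integral>\<^sup>+ t. ennreal (2 * t) * indicator {0..} t * (\<integral>\<^sup>+ s. p t s \<partial>lborel) ^ d \<partial>lborel)"
  proof (rule nn_integral_cong)
    fix t :: real
    have [measurable]: "p t \<in> borel_measurable borel" unfolding p_def by measurable
    have "(\<integral>\<^sup>+ x. h x t \<partial>?L) = (\<integral>\<^sup>+ x. ennreal (2 * t) * indicator {0..} t * (\<Prod>i<d. p t (x $ i)) \<partial>?L)"
      by (intro nn_integral_cong) (simp add: h_def p_def indicator_def of_bool_def)
    also have "\<dots> = ennreal (2 * t) * indicator {0..} t * (\<integral>\<^sup>+ x. (\<Prod>i<d. p t (x $ i)) \<partial>?L)"
      by (rule nn_integral_cmult) measurable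
    also have "(\<integral>\<^sup>+ x. (\<Prod>i<d. p t (x $ i)) \<partial>?L) = (\<integral>\<^sup>+ s. p t s \<partial>lborel) ^ d"
      by (subst nn_integral_vec_lborel_prod) auto
    finally show "(\<integral>\<^sup>+ x. h x t \<partial>?L) = ennreal (2 * t) * indicator {0..} t * (\<integral>\<^sup>+ s. p t s \<partial>lborel) ^ d" .
  qed
  also have "\<dots> \<le> (\<integral>\<^sup>+ t. ennreal (2 * t * exp (- (d * c) * t)) * indicator {0..} t \<partial>lborel)"
  proof (rule nn_integral_mono)
    fix t :: real
    show "ennreal (2 * t) * indicator {0..} t * (\<integral>\<^sup>+ s. p t s \<partial>lborel) ^ d
        \<le> ennreal (2 * t * exp (- (d * c) * t)) * indicator {0..} t"
    proof (cases "0 \<le> t")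
      case True
      have "(\<integral>\<^sup>+ s. p t s \<partial>lborel) ^ d \<le> ennreal (exp (- c * t)) ^ d"
        unfolding p_def c_def using std_normal_tail_le[OF True] by (rule power_mono) simp
      also have "\<dots> = ennreal (exp (- (d * c) * t))"
        by (simp add: ennreal_power exp_of_nat_mult[symmetric] mult_ac)
      finally have "ennreal (2 * t) * (\<integral>\<^sup>+ s. p t s \<partial>lborel) ^ d \<le> ennreal (2 * t) * ennreal (exp (- (d * c) * t))"
        by (rule mult_left_mono) simp
      with True show ?thesis by (simp add: ennreal_mult')
    qed simp
  qed
  also have "\<dots> = ennreal (2 / (d * c)\<^sup>2)"
    using d c by (intro nn_integral_two_exp) auto
  also have "2 / (d * c)\<^sup>2 = pi / (real d)\<^sup>2"
    by (simp add: power_mult_distrib c)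
  finally show ?thesis .
qed

lemma gauss_second_moment:
  "(\<integral>\<^sup>+ x. ennreal (x \<bullet> x) * gauss_density d x \<partial>vec_lborel d) = of_nat d"
proof -
  have std: "(\<integral>\<^sup>+ t. ennreal (t\<^sup>2) * ennreal (std_normal_density t) \<partial>lborel) = 1"
  proof -
    have "has_bochner_integral lborel (\<lambda>t. std_normal_density t * t ^ (2 * 1)) 1"
      using std_normal_moment_even[of 1] by (simp add: fact_2)
    then have "(\<integral>\<^sup>+ t. ennreal (std_normal_density t * t ^ (2 * 1)) \<partial>lborel) = ennreal 1"
      by (subst nn_integral_eq_integral) (auto simp: has_bochner_integral_iff)
    then show ?thesis by (simp add: ennreal_mult'[symmetric] mult.commute)
  qed
  let ?f = "\<lambda>i j t. (if j = i then ennreal (t\<^sup>2) else 1) * ennreal (std_normal_density t)"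
  have one: "(\<integral>\<^sup>+ t. ?f i j t \<partial>lborel) = 1" for i j :: nat
    by (cases "j = i") (simp_all add: std nn_integral_std_normal_density)
  have "(\<integral>\<^sup>+ x. ennreal (x \<bullet> x) * gauss_density d x \<partial>vec_lborel d)
      = (\<integral>\<^sup>+ x. (\<Sum>i<d. \<Prod>j<d. ?f i j (x $ j)) \<partial>vec_lborel d)"
  proof (rule nn_integral_cong)
    fix x assume "x \<in> space (vec_lborel d)"
    then have "x \<bullet> x = (\<Sum>i<d. (x $ i)\<^sup>2)"
      by (simp add: scalar_prod_eq_sum[of x d] power2_eq_square)
    then have "ennreal (x \<bullet> x) * gauss_density d x = (\<Sum>i<d. ennreal ((x $ i)\<^sup>2) * gauss_density d x)"
      by (simp add: sum_distrib_right flip: sum_ennreal)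
    also have "\<dots> = (\<Sum>i<d. \<Prod>j<d. ?f i j (x $ j))"
      by (intro sum.cong) (auto simp: prod.distrib gauss_density_def)
    finally show "ennreal (x \<bullet> x) * gauss_density d x = (\<Sum>i<d. \<Prod>j<d. ?f i j (x $ j))" .
  qed
  also have "\<dots> = (\<Sum>i<d. \<integral>\<^sup>+ x. (\<Prod>j<d. ?f i j (x $ j)) \<partial>vec_lborel d)"
    by (rule nn_integral_sum) measurable
  also have "\<dots> = (\<Sum>i<d. \<Prod>j<d. \<integral>\<^sup>+ t. ?f i j t \<partial>lborel)"
    by (intro sum.cong refl nn_integral_vec_lborel_prod) auto
  also have "\<dots> = (\<Sum>i<d. 1)"
    by (simp add: one)
  finally show ?thesis by simp
qed

section \<open>The score as a function of the unit eigenvectors\<close>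

definition unit_eigenvectors :: "nat \<Rightarrow> real mat \<Rightarrow> real vec set" where
  "unit_eigenvectors d a = {u \<in> carrier_vec d. u \<bullet> u = 1 \<and> (\<exists>l. a *\<^sub>v u = l \<cdot>\<^sub>v u)}"

text \<open>The infimum runs over all unit eigenvectors, which avoids the choice of an eigenbasis. Values are
  extended nonnegative reals, so a matrix without real eigenvectors has score \<open>\<infinity>\<close>.\<close>

definition eigenvector_score :: "nat \<Rightarrow> real mat \<Rightarrow> real vec \<Rightarrow> ennreal" where
  "eigenvector_score d a x = (INF u\<in>unit_eigenvectors d a. ennreal ((u \<bullet> x)\<^sup>2))"

text \<open>Conjugation by \<open>T\<close> maps each unit eigenvector \<open>u\<close> to \<open>T u\<close>, and \<open>T\<close> preserves scalar products. Applied
  to the transpose, the inequality becomes an equality.\<close>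

lemma eigenvector_score_orthogonal_le:
  assumes T: "T \<in> orthogonal_group d" and a: "a \<in> carrier_mat d d" and x: "x \<in> carrier_vec d"
  shows "eigenvector_score d (T * a * T\<^sup>T) (T *\<^sub>v x) \<le> eigenvector_score d a x"
  unfolding eigenvector_score_def
proof (rule INF_greatest)
  fix u assume u: "u \<in> unit_eigenvectors d a"
  then obtain l where uc: "u \<in> carrier_vec d" and uu: "u \<bullet> u = 1" and l: "a *\<^sub>v u = l \<cdot>\<^sub>v u"
    by (auto simp: unit_eigenvectors_def)
  note TC = orthogonal_groupD(1,2)[OF T]
  have "(T * a * T\<^sup>T) *\<^sub>v (T *\<^sub>v u) = (T * a) *\<^sub>v (T\<^sup>T *\<^sub>v (T *\<^sub>v u))"
    using TC a uc by (intro assoc_mult_mat_vec[of _ d d]) auto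
  also have "\<dots> = T *\<^sub>v (a *\<^sub>v u)"
    unfolding orthogonal_group_inverse[OF T uc] using TC a uc by (intro assoc_mult_mat_vec[of _ d d]) auto
  also have "\<dots> = l \<cdot>\<^sub>v (T *\<^sub>v u)"
    unfolding l using TC uc by (intro mult_mat_vec[of T d d]) auto
  finally have "T *\<^sub>v u \<in> unit_eigenvectors d (T * a * T\<^sup>T)"
    using TC uc uu orthogonal_group_scalar_prod[OF T uc uc] by (auto simp: unit_eigenvectors_def)
  from INF_lower[OF this, of "\<lambda>u. ennreal ((u \<bullet> (T *\<^sub>v x))\<^sup>2)"]
  show "(INF u\<in>unit_eigenvectors d (T * a * T\<^sup>T). ennreal ((u \<bullet> (T *\<^sub>v x))\<^sup>2)) \<le> ennreal ((u \<bullet> x)\<^sup>2)"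
    by (simp only: orthogonal_group_scalar_prod[OF T uc x])
qed

lemma eigenvector_score_smult_le:
  assumes s: "s > 0" and x: "x \<in> carrier_vec d"
  shows "eigenvector_score d a (s \<cdot>\<^sub>v x) \<le> ennreal (s\<^sup>2) * eigenvector_score d a x"
proof -
  have "ennreal (1 / s\<^sup>2) * eigenvector_score d a (s \<cdot>\<^sub>v x) \<le> eigenvector_score d a x"
    unfolding eigenvector_score_def[of d a x]
  proof (rule INF_greatest)
    fix u assume u: "u \<in> unit_eigenvectors d a"
    then have "u \<in> carrier_vec d" by (simp add: unit_eigenvectors_def)
    then have ux: "u \<bullet> (s \<cdot>\<^sub>v x) = s * (u \<bullet> x)" using x by simp
    have "eigenvector_score d a (s \<cdot>\<^sub>v x) \<le> ennreal ((u \<bullet> (s \<cdot>\<^sub>v x))\<^sup>2)"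
      unfolding eigenvector_score_def using u by (rule INF_lower)
    then have "ennreal (1 / s\<^sup>2) * eigenvector_score d a (s \<cdot>\<^sub>v x)
        \<le> ennreal (1 / s\<^sup>2) * ennreal ((u \<bullet> (s \<cdot>\<^sub>v x))\<^sup>2)"
      by (rule mult_left_mono) simp
    also have "\<dots> = ennreal ((u \<bullet> x)\<^sup>2)"
      using s unfolding ux by (simp add: ennreal_mult'[symmetric] power_mult_distrib)
    finally show "ennreal (1 / s\<^sup>2) * eigenvector_score d a (s \<cdot>\<^sub>v x) \<le> ennreal ((u \<bullet> x)\<^sup>2)" .
  qed
  then have "ennreal (s\<^sup>2) * (ennreal (1 / s\<^sup>2) * eigenvector_score d a (s \<cdot>\<^sub>v x))
      \<le> ennreal (s\<^sup>2) * eigenvector_score d a x"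
    by (rule mult_left_mono) simp
  also have "ennreal (s\<^sup>2) * (ennreal (1 / s\<^sup>2) * eigenvector_score d a (s \<cdot>\<^sub>v x))
      = eigenvector_score d a (s \<cdot>\<^sub>v x)"
    using s by (simp add: ennreal_mult'[symmetric] flip: mult.assoc)
  finally show ?thesis .
qed

text \<open>A simple real spectrum makes the spectral theorem elementary: there are \<open>d\<close> eigenvectors for
  distinct eigenvalues, symmetry makes them pairwise orthogonal, and normalised they are the columns
  of \<open>Q\<close>.\<close>

lemma orthogonally_diagonalizes_exists:
  fixes a :: "real mat"
  assumes a: "a \<in> carrier_mat d d" and sym: "a\<^sup>T = a" and card: "card (spectrum a) = d" and d: "d \<ge> 1"
  shows "\<exists>Q. orthogonally_diagonalizes Q a"
proof -
  have "finite (spectrum a)"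
    using card d by (intro card_ge_0_finite) simp
  then obtain lam where lam: "bij_betw lam {0..<d} (spectrum a)"
    using ex_bij_betw_nat_finite card by blast
  have "\<exists>v. eigenvector a v (lam i)" if "i < d" for i
    using bij_betwE[OF lam] that by (auto simp: spectrum_def eigenvalue_def)
  then obtain v where v: "\<And>i. i < d \<Longrightarrow> eigenvector a (v i) (lam i)" by metis
  define q where "q i = (1 / sqrt (v i \<bullet> v i)) \<cdot>\<^sub>v v i" for i
  have vc: "v i \<in> carrier_vec d" if "i < d" for i
    using v[OF that] a by (auto simp: eigenvector_def)
  have qc: "q i \<in> carrier_vec d" if "i < d" for i
    using vc[OF that] by (simp add: q_def)
  have qq: "q i \<bullet> q i = 1" if i: "i < d" for i
  proof -
    have "v i \<bullet> v i \<noteq> 0"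
      using scalar_prod_self_eq_0[OF vc[OF i]] v[OF i] a by (auto simp: eigenvector_def)
    then show ?thesis
      using scalar_prod_self_nonneg[of "v i"]
      by (simp add: q_def divide_simps flip: real_sqrt_mult)
  qed
  have aq: "a *\<^sub>v q i = lam i \<cdot>\<^sub>v q i" if i: "i < d" for i
    using v[OF i] vc[OF i] mult_mat_vec[OF a vc[OF i]]
    by (simp add: q_def eigenvector_def smult_smult_assoc mult.commute)
  have orth: "q i \<bullet> q j = 0" if i: "i < d" and j: "j < d" and ij: "i \<noteq> j" for i j
  proof -
    have "lam i * (q i \<bullet> q j) = (a *\<^sub>v q i) \<bullet> q j"
      using qc[OF i] qc[OF j] by (simp add: aq[OF i])
    also have "\<dots> = q i \<bullet> (a *\<^sub>v q j)"
      using transpose_scalar_prod[OF a qc[OF i] qc[OF j]] sym by simp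
    also have "\<dots> = lam j * (q i \<bullet> q j)"
      using qc[OF i] qc[OF j] by (simp add: aq[OF j])
    finally show ?thesis
      using bij_betw_imp_inj_on[OF lam] i j ij by (auto dest: inj_onD)
  qed
  define Q where "Q = mat d d (\<lambda>(i, j). q j $ i)"
  define L where "L = mat d d (\<lambda>(i, j). if i = j then lam i else 0)"
  have QC: "Q \<in> carrier_mat d d" "Q\<^sup>T \<in> carrier_mat d d" and LC: "L \<in> carrier_mat d d"
    by (auto simp: Q_def L_def)
  have QQ: "Q\<^sup>T * Q = 1\<^sub>m d"
  proof (intro eq_matI)
    fix i j assume ij: "i < dim_row (1\<^sub>m d :: real mat)" "j < dim_col (1\<^sub>m d :: real mat)"
    have "(Q\<^sup>T * Q) $$ (i, j) = (\<Sum>k<d. q i $ k * q j $ k)"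
      using ij by (subst mult_mat_index[of _ d d _ d]) (auto simp: Q_def)
    also have "\<dots> = q i \<bullet> q j"
      using qc ij by (simp add: scalar_prod_eq_sum[of _ d])
    finally show "(Q\<^sup>T * Q) $$ (i, j) = 1\<^sub>m d $$ (i, j)"
      using ij qq orth by auto
  qed (use QC in auto)
  then have QQ': "Q * Q\<^sup>T = 1\<^sub>m d"
    by (rule mat_mult_left_right_inverse[OF QC(2) QC(1)])
  have "a * Q = Q * L"
  proof (intro eq_matI)
    fix i j assume "i < dim_row (Q * L)" "j < dim_col (Q * L)"
    then have ij: "i < d" "j < d" using QC LC by auto
    have "(a * Q) $$ (i, j) = (\<Sum>k<d. a $$ (i, k) * q j $ k)"
      using ij a by (subst mult_mat_index[of _ d d _ d]) (auto simp: Q_def)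
    also have "\<dots> = (a *\<^sub>v q j) $ i"
      using mult_mat_vec_index[OF a qc[OF ij(2)] ij(1)] by simp
    also have "\<dots> = q j $ i * lam j"
      using qc[OF ij(2)] ij by (simp add: aq)
    also have "\<dots> = (\<Sum>k<d. if k = j then q j $ i * lam j else 0)"
      using ij by simp
    also have "\<dots> = (\<Sum>k<d. Q $$ (i, k) * L $$ (k, j))"
      using ij by (intro sum.cong) (auto simp: Q_def L_def)
    also have "\<dots> = (Q * L) $$ (i, j)"
      using ij QC LC by (subst mult_mat_index[of _ d d _ d]) auto
    finally show "(a * Q) $$ (i, j) = (Q * L) $$ (i, j)" .
  qed (use a QC LC in auto)
  then have "Q * L * Q\<^sup>T = a * (Q * Q\<^sup>T)"
    using a QC assoc_mult_mat[OF a QC] by simp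
  then have "a = Q * L * Q\<^sup>T"
    using a QQ' by simp
  moreover have "diagonal_mat L"
    by (simp add: diagonal_mat_def L_def)
  moreover have "Q \<in> orthogonal_group d"
    using QC QQ QQ' by (simp add: orthogonal_group_def)
  ultimately show ?thesis
    unfolding orthogonally_diagonalizes_def carrier_matD(1)[OF a] using LC by blast
qed

text \<open>The unit eigenvectors are exactly the columns of \<open>Q\<close> up to sign. If \<open>u\<close> is one, then \<open>Q' u\<close> is an
  eigenvector of a diagonal matrix with distinct diagonal entries, hence supported on a single
  coordinate.\<close>

lemma unit_eigenvectors_diagonalized:
  fixes a :: "real mat"
  assumes a: "a \<in> carrier_mat d d" and card: "card (spectrum a) = d"
    and Q: "orthogonally_diagonalizes Q a"
  shows "Q \<in> orthogonal_group d"
    and "i < d \<Longrightarrow> \<exists>u \<in> unit_eigenvectors d a. \<forall>x \<in> carrier_vec d. u \<bullet> x = (Q\<^sup>T *\<^sub>v x) $ i"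
    and "u \<in> unit_eigenvectors d a \<Longrightarrow> \<exists>i<d. \<forall>x \<in> carrier_vec d. (u \<bullet> x)\<^sup>2 = ((Q\<^sup>T *\<^sub>v x) $ i)\<^sup>2"
proof -
  from Q a obtain L where QO: "Q \<in> orthogonal_group d" and LC: "L \<in> carrier_mat d d"
    and Ld: "diagonal_mat L" and aL: "a = Q * L * Q\<^sup>T"
    by (auto simp: orthogonally_diagonalizes_def)
  show "Q \<in> orthogonal_group d" by (rule QO)
  note QC = orthogonal_groupD(1,2)[OF QO]
  note inv = orthogonal_group_inverse[OF QO]
  have av: "a *\<^sub>v y = Q *\<^sub>v (L *\<^sub>v (Q\<^sup>T *\<^sub>v y))" if "y \<in> carrier_vec d" for y
  proof -
    have "a *\<^sub>v y = (Q * L) *\<^sub>v (Q\<^sup>T *\<^sub>v y)"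
      unfolding aL using QC LC that by (intro assoc_mult_mat_vec[of _ d d]) auto
    also have "\<dots> = Q *\<^sub>v (L *\<^sub>v (Q\<^sup>T *\<^sub>v y))"
      using QC LC that by (intro assoc_mult_mat_vec[of _ d d]) auto
    finally show ?thesis .
  qed
  have Lv: "(L *\<^sub>v y) $ i = L $$ (i, i) * y $ i" if "y \<in> carrier_vec d" "i < d" for y i
  proof -
    have "(L *\<^sub>v y) $ i = (\<Sum>j<d. L $$ (i, j) * y $ j)"
      by (rule mult_mat_vec_index[OF LC that])
    also have "\<dots> = (\<Sum>j<d. if j = i then L $$ (i, i) * y $ i else 0)"
      using Ld LC that by (intro sum.cong) (auto simp: diagonal_mat_def)
    finally show ?thesis using that by simp
  qed
  have eig: "L $$ (i, i) * (Q\<^sup>T *\<^sub>v y) $ i = l * (Q\<^sup>T *\<^sub>v y) $ i"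
    if y: "y \<in> carrier_vec d" and l: "a *\<^sub>v y = l \<cdot>\<^sub>v y" and i: "i < d" for y l i
  proof -
    have Qy: "Q\<^sup>T *\<^sub>v y \<in> carrier_vec d" "L *\<^sub>v (Q\<^sup>T *\<^sub>v y) \<in> carrier_vec d"
      using QC LC y by auto
    have "L *\<^sub>v (Q\<^sup>T *\<^sub>v y) = Q\<^sup>T *\<^sub>v (a *\<^sub>v y)"
      unfolding av[OF y] inv(1)[OF Qy(2)] ..
    also have "\<dots> = l \<cdot>\<^sub>v (Q\<^sup>T *\<^sub>v y)"
      unfolding l by (rule mult_mat_vec[OF QC(2) y])
    finally have "(L *\<^sub>v (Q\<^sup>T *\<^sub>v y)) $ i = (l \<cdot>\<^sub>v (Q\<^sup>T *\<^sub>v y)) $ i" by simp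
    then show ?thesis using Lv[OF Qy(1) i] carrier_vecD[OF Qy(1)] i by (simp only: index_smult_vec)
  qed
  have nonzero: "\<exists>i<d. (Q\<^sup>T *\<^sub>v y) $ i \<noteq> 0" if y: "y \<in> carrier_vec d" and y0: "y \<bullet> y \<noteq> 0" for y
  proof (rule ccontr)
    assume "\<not> ?thesis"
    then have "(Q\<^sup>T *\<^sub>v y) \<bullet> (Q\<^sup>T *\<^sub>v y) = 0"
      using QC y by (subst scalar_prod_eq_sum[of _ d]) auto
    with y0 orthogonal_group_scalar_prod[OF orthogonal_group_transpose[OF QO] y y]
    show False by simp
  qed
  show "\<exists>u \<in> unit_eigenvectors d a. \<forall>x \<in> carrier_vec d. u \<bullet> x = (Q\<^sup>T *\<^sub>v x) $ i" if i: "i < d"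
  proof (intro bexI ballI)
    let ?e = "unit_vec d i :: real vec"
    let ?u = "Q *\<^sub>v ?e"
    have "L *\<^sub>v ?e = L $$ (i, i) \<cdot>\<^sub>v ?e"
      using LC Ld i by (intro eq_vecI) (auto simp: Lv diagonal_mat_def)
    then have "a *\<^sub>v ?u = L $$ (i, i) \<cdot>\<^sub>v ?u"
      using QC by (simp add: av inv(1) mult_mat_vec[OF QC(1)])
    moreover have "?u \<bullet> ?u = 1"
      using i by (simp add: orthogonal_group_scalar_prod[OF QO])
    ultimately show "?u \<in> unit_eigenvectors d a"
      using QC by (auto simp: unit_eigenvectors_def)
    fix x :: "real vec" assume x: "x \<in> carrier_vec d"
    show "?u \<bullet> x = (Q\<^sup>T *\<^sub>v x) $ i"
      using transpose_scalar_prod[OF QC(1) _ x, of ?e] QC x i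
      by (simp del: mult_mat_vec_def index_mult_mat_vec add: scalar_prod_left_unit[of _ d])
  qed
  have "spectrum a \<subseteq> (\<lambda>i. L $$ (i, i)) ` {..<d}"
  proof
    fix l assume "l \<in> spectrum a"
    then obtain y where y: "y \<in> carrier_vec d" "y \<noteq> 0\<^sub>v d" "a *\<^sub>v y = l \<cdot>\<^sub>v y"
      using a by (auto simp: spectrum_def eigenvalue_def eigenvector_def)
    then obtain i where "i < d" "(Q\<^sup>T *\<^sub>v y) $ i \<noteq> 0"
      using nonzero scalar_prod_self_eq_0 by blast
    with eig[OF y(1,3)] show "l \<in> (\<lambda>i. L $$ (i, i)) ` {..<d}" by force
  qed
  then have "d \<le> card ((\<lambda>i. L $$ (i, i)) ` {..<d})"
    using card card_mono[of "(\<lambda>i. L $$ (i, i)) ` {..<d}" "spectrum a"] by simp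
  then have inj: "inj_on (\<lambda>i. L $$ (i, i)) {..<d}"
    using card_image_le[of "{..<d}" "\<lambda>i. L $$ (i, i)"] by (intro eq_card_imp_inj_on) auto
  show "\<exists>i<d. \<forall>x \<in> carrier_vec d. (u \<bullet> x)\<^sup>2 = ((Q\<^sup>T *\<^sub>v x) $ i)\<^sup>2" if u: "u \<in> unit_eigenvectors d a"
  proof -
    obtain l where uc: "u \<in> carrier_vec d" and uu: "u \<bullet> u = 1" and l: "a *\<^sub>v u = l \<cdot>\<^sub>v u"
      using u by (auto simp: unit_eigenvectors_def)
    let ?c = "Q\<^sup>T *\<^sub>v u"
    have cc: "?c \<in> carrier_vec d" using QC uc by simp
    obtain i where i: "i < d" and ci: "?c $ i \<noteq> 0"
      using nonzero[OF uc] uu by auto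
    have other: "?c $ j = 0" if "j < d" "j \<noteq> i" for j
      using eig[OF uc l that(1)] eig[OF uc l i] ci inj that i by (auto dest: inj_onD)
    have prod: "?c \<bullet> y = ?c $ i * y $ i" if "y \<in> carrier_vec d" for y
    proof -
      have "?c \<bullet> y = (\<Sum>j<d. if j = i then ?c $ i * y $ i else 0)"
        unfolding scalar_prod_eq_sum[OF that] using other by (intro sum.cong) auto
      then show ?thesis using i by simp
    qed
    have same: "u \<bullet> x = ?c \<bullet> (Q\<^sup>T *\<^sub>v x)" if "x \<in> carrier_vec d" for x
      using orthogonal_group_scalar_prod[OF orthogonal_group_transpose[OF QO] uc that] by simp
    have "?c $ i * ?c $ i = 1"
      using prod[OF cc] same[OF uc] uu by simp
    then have "(u \<bullet> x)\<^sup>2 = ((Q\<^sup>T *\<^sub>v x) $ i)\<^sup>2" if x: "x \<in> carrier_vec d" for x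
    proof -
      have "Q\<^sup>T *\<^sub>v x \<in> carrier_vec d" using QC x by simp
      then show ?thesis
        using \<open>?c $ i * ?c $ i = 1\<close> unfolding same[OF x] prod[OF \<open>Q\<^sup>T *\<^sub>v x \<in> carrier_vec d\<close>]
        by (simp only: power_mult_distrib) (simp only: power2_eq_square mult_1)
    qed
    with i show ?thesis by blast
  qed
qed

lemma icis_le_eigenvector_score:
  assumes a: "a \<in> carrier_mat d d" and sym: "a\<^sup>T = a" and card: "card (spectrum a) = d"
    and d: "d \<ge> 1" and x: "x \<in> carrier_vec d"
  shows "ennreal ((icis a x)\<^sup>2) \<le> eigenvector_score d a x"
  unfolding eigenvector_score_def
proof (rule INF_greatest)
  fix u assume u: "u \<in> unit_eigenvectors d a"
  define Q where "Q = (SOME Q. orthogonally_diagonalizes Q a)"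
  have Q: "orthogonally_diagonalizes Q a"
    unfolding Q_def by (rule someI_ex[OF orthogonally_diagonalizes_exists[OF a sym card d]])
  obtain i where i: "i < d" and ui: "(u \<bullet> x)\<^sup>2 = ((Q\<^sup>T *\<^sub>v x) $ i)\<^sup>2"
    using unit_eigenvectors_diagonalized(3)[OF a card Q u] x by blast
  have icis: "icis a x = (MIN i\<in>{..<d}. \<bar>(Q\<^sup>T *\<^sub>v x) $ i\<bar>)"
    using a by (simp add: icis_def Let_def flip: Q_def)
  have "icis a x \<le> \<bar>(Q\<^sup>T *\<^sub>v x) $ i\<bar>"
    unfolding icis using i by (intro Min_le) auto
  moreover have "0 \<le> icis a x"
    unfolding icis using i by (subst Min_ge_iff) auto
  ultimately have "(icis a x)\<^sup>2 \<le> \<bar>(Q\<^sup>T *\<^sub>v x) $ i\<bar>\<^sup>2"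
    by (intro power_mono) auto
  then show "ennreal ((icis a x)\<^sup>2) \<le> ennreal ((u \<bullet> x)\<^sup>2)"
    unfolding ui by (intro ennreal_leI) simp
qed

lemma eigenvector_score_le_min:
  assumes a: "a \<in> carrier_mat d d" and card: "card (spectrum a) = d"
    and Q: "orthogonally_diagonalizes Q a" and d: "d \<ge> 1" and x: "x \<in> carrier_vec d"
  shows "eigenvector_score d a x \<le> ennreal ((MIN i\<in>{..<d}. \<bar>(Q\<^sup>T *\<^sub>v x) $ i\<bar>)\<^sup>2)"
proof -
  have "{..<d} \<noteq> {}" using d by (simp add: lessThan_empty_iff)
  then have "(MIN i\<in>{..<d}. \<bar>(Q\<^sup>T *\<^sub>v x) $ i\<bar>) \<in> (\<lambda>i. \<bar>(Q\<^sup>T *\<^sub>v x) $ i\<bar>) ` {..<d}"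
    by (intro Min_in) auto
  then obtain i where i: "i < d" and m: "(MIN i\<in>{..<d}. \<bar>(Q\<^sup>T *\<^sub>v x) $ i\<bar>) = \<bar>(Q\<^sup>T *\<^sub>v x) $ i\<bar>"
    by auto
  obtain u where u: "u \<in> unit_eigenvectors d a" and ux: "u \<bullet> x = (Q\<^sup>T *\<^sub>v x) $ i"
    using unit_eigenvectors_diagonalized(2)[OF a card Q i] x by blast
  have "eigenvector_score d a x \<le> ennreal ((u \<bullet> x)\<^sup>2)"
    unfolding eigenvector_score_def using u by (rule INF_lower)
  then show ?thesis unfolding m ux by simp
qed

section \<open>Measurability of the eigenvector score\<close>

text \<open>For nonempty \<open>K\<close> a zero exists if and only if the
  infimum over \<open>K\<close> is zero, and by continuity that infimum may be taken over a countable dense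
  subset.\<close>

lemma measurable_compact_exists_zero:
  fixes h :: "'z \<Rightarrow> 'k::{metric_space, second_countable_topology} \<Rightarrow> real"
  assumes K: "compact K"
    and cont: "\<And>z. z \<in> space N \<Longrightarrow> continuous_on K (h z)"
    and meas: "\<And>u. u \<in> K \<Longrightarrow> (\<lambda>z. h z u) \<in> borel_measurable N"
    and nonneg: "\<And>z u. z \<in> space N \<Longrightarrow> u \<in> K \<Longrightarrow> 0 \<le> h z u"
  shows "{z \<in> space N. \<exists>u\<in>K. h z u = 0} \<in> sets N"
proof -
  obtain D where D: "countable D" "D \<subseteq> K" "K \<subseteq> closure D"
    using separable[of K] by blast
  have "{z \<in> space N. \<exists>u\<in>K. h z u = 0}
      = (\<Inter>n::nat. \<Union>u\<in>D. {z \<in> space N. h z u < 1 / real (Suc n)})" (is "?A = ?B")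
  proof (intro equalityI subsetI)
    fix z assume "z \<in> ?A"
    then obtain u where z: "z \<in> space N" and u: "u \<in> K" "h z u = 0" by auto
    have "\<exists>v\<in>D. h z v < 1 / real (Suc n)" for n
    proof -
      have "eventually (\<lambda>v. h z v < 1 / real (Suc n)) (at u within K)"
        using cont[OF z] u by (intro order_tendstoD(2)[of _ "h z u"]) (auto simp: continuous_on_def)
      then obtain e where e: "e > 0" "\<And>v. v \<in> K \<Longrightarrow> v \<noteq> u \<Longrightarrow> dist v u < e \<Longrightarrow> h z v < 1 / real (Suc n)"
        unfolding eventually_at by blast
      obtain v where v: "v \<in> D" "dist v u < e"
        using D(3) u(1) e(1) closure_approachable[of u D] by blast
      show ?thesis
      proof (cases "v = u")
        case True
        then show ?thesis using v u(2) by (intro bexI[of _ v]) auto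
      next
        case False
        then show ?thesis using e(2) v D(2) by (intro bexI[of _ v]) auto
      qed
    qed
    then show "z \<in> ?B" using z by auto
  next
    fix z assume "z \<in> ?B"
    then have z: "z \<in> space N" and *: "\<exists>v\<in>D. h z v < 1 / real (Suc n)" for n by auto
    have "K \<noteq> {}" using *[of 0] D(2) by auto
    then obtain u where u: "u \<in> K" "\<And>v. v \<in> K \<Longrightarrow> h z u \<le> h z v"
      using continuous_attains_inf[OF K _ cont[OF z]] by blast
    have "h z u < 1 / real (Suc n)" for n
      using *[of n] u(2) D(2) by (metis order_le_less_trans subsetD)
    then have "\<not> 0 < h z u"
      using reals_Archimedean[of "h z u"] by (metis inverse_eq_divide not_less_iff_gr_or_eq)
    then show "z \<in> ?A"
      using z u(1) nonneg[OF z u(1)] by force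
  qed
  also have "\<dots> \<in> sets N"
  proof (intro sets.countable_INT sets.countable_UN' D(1) image_subsetI)
    fix n u assume "u \<in> D"
    then have "(\<lambda>z. h z u) \<in> borel_measurable N" using D(2) meas by blast
    from borel_measurable_less[OF this borel_measurable_const]
    show "{z \<in> space N. h z u < 1 / real (Suc n)} \<in> sets N" .
  qed auto
  finally show ?thesis .
qed

text \<open>The unit sphere is parametrised by functions on all natural numbers, which form a separable metric
  space in the product topology whatever \<open>d\<close> is. Only the first \<open>d\<close> values enter the vector; bounding
  every value by 1 makes the set of parameters compact.\<close>

definition sphere_coords :: "nat \<Rightarrow> (nat \<Rightarrow> real) set" where
  "sphere_coords d = (UNIV \<rightarrow>\<^sub>E {-1..1}) \<inter> {f. (\<Sum>i<d. f i * f i) = 1}"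

lemma compact_sphere_coords: "compact (sphere_coords d)"
proof -
  have "compactin (product_topology (\<lambda>_::nat. euclidean :: real topology) UNIV) (UNIV \<rightarrow>\<^sub>E {-1..1})"
    by (simp add: compactin_PiE)
  then have "compact (UNIV \<rightarrow>\<^sub>E {-1..1} :: (nat \<Rightarrow> real) set)"
    by (simp add: euclidean_product_topology)
  moreover have "closed {f :: nat \<Rightarrow> real. (\<Sum>i<d. f i * f i) = 1}"
    by (intro closed_Collect_eq continuous_intros continuous_on_product_coordinates)
  ultimately show ?thesis
    unfolding sphere_coords_def by (rule compact_Int_closed)
qed

lemma vec_image_sphere_coords: "vec d ` sphere_coords d = {u \<in> carrier_vec d. u \<bullet> u = 1}"
proof (intro equalityI subsetI)
  fix u assume "u \<in> vec d ` sphere_coords d"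
  then show "u \<in> {u \<in> carrier_vec d. u \<bullet> u = 1}"
    by (auto simp: sphere_coords_def scalar_prod_eq_sum[of _ d])
next
  fix u :: "real vec" assume "u \<in> {u \<in> carrier_vec d. u \<bullet> u = 1}"
  then have u: "u \<in> carrier_vec d" and uu: "(\<Sum>i<d. u $ i * u $ i) = 1"
    by (auto simp: scalar_prod_eq_sum[of _ d])
  let ?f = "\<lambda>i. if i < d then u $ i else 0"
  have "u $ i \<in> {-1..1}" if "i < d" for i
  proof -
    have "u $ i * u $ i \<le> (\<Sum>i<d. u $ i * u $ i)"
      using that by (intro member_le_sum) auto
    then have "(u $ i)\<^sup>2 \<le> 1" using uu by (simp add: power2_eq_square)
    then show ?thesis by (simp add: abs_square_le_1 abs_le_iff minus_le_iff)
  qed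
  then have "?f \<in> sphere_coords d"
    using uu by (auto simp: sphere_coords_def PiE_iff)
  moreover have "u = vec d ?f"
    using u by (intro eq_vecI) auto
  ultimately show "u \<in> vec d ` sphere_coords d" by blast
qed

text \<open>This is the squared norm of \<open>a u - (u \<bullet> a u) u\<close> for \<open>u = vec d f\<close>. A unit vector can only be an
  eigenvector for its Rayleigh quotient \<open>u \<bullet> a u\<close>, so being an eigenvector becomes a single equation
  that is continuous in \<open>f\<close>.\<close>

definition eigen_residual :: "nat \<Rightarrow> real mat \<Rightarrow> (nat \<Rightarrow> real) \<Rightarrow> real" where
  "eigen_residual d a f = (\<Sum>i<d. ((\<Sum>j<d. a $$ (i, j) * f j)
     - (\<Sum>k<d. f k * (\<Sum>j<d. a $$ (k, j) * f j)) * f i)\<^sup>2)"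

lemma eigen_residual_eq_0_iff:
  assumes a: "a \<in> carrier_mat d d" and f: "f \<in> sphere_coords d"
  shows "eigen_residual d a f = 0 \<longleftrightarrow> vec d f \<in> unit_eigenvectors d a"
proof -
  let ?u = "vec d f"
  define l where "l = ?u \<bullet> (a *\<^sub>v ?u)"
  have uu: "?u \<bullet> ?u = 1"
    using f vec_image_sphere_coords[of d] by blast
  have au: "(a *\<^sub>v ?u) $ i = (\<Sum>j<d. a $$ (i, j) * f j)" if "i < d" for i
    using mult_mat_vec_index[OF a _ that, of ?u] by simp
  have "l = (\<Sum>k<d. f k * (\<Sum>j<d. a $$ (k, j) * f j))"
    using a by (simp add: l_def scalar_prod_eq_sum[of "a *\<^sub>v ?u" d] au del: index_mult_mat_vec)
  then have "eigen_residual d a f = (\<Sum>i<d. ((a *\<^sub>v ?u) $ i - l * f i)\<^sup>2)"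
    by (simp add: eigen_residual_def au del: index_mult_mat_vec)
  then have "eigen_residual d a f = 0 \<longleftrightarrow> (\<forall>i<d. (a *\<^sub>v ?u) $ i = l * f i)"
    by (auto simp add: sum_nonneg_eq_0_iff simp del: index_mult_mat_vec)
  also have "\<dots> \<longleftrightarrow> a *\<^sub>v ?u = l \<cdot>\<^sub>v ?u"
    using a by (auto simp: vec_eq_iff simp del: index_mult_mat_vec)
  also have "\<dots> \<longleftrightarrow> ?u \<in> unit_eigenvectors d a"
    using uu by (auto simp: unit_eigenvectors_def l_def)
  finally show ?thesis .
qed

text \<open>The score is below \<open>y\<close> if and only if for some rational \<open>s\<close> below \<open>y\<close> there is a unit eigenvector \<open>u\<close>
  with \<open>(u \<bullet> x)\<^sup>2 \<le> s\<close>. For each \<open>s\<close> this asks for a zero on the compact sphere of a nonnegative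
  continuous function: the eigenvector residual plus the excess of \<open>(u \<bullet> x)\<^sup>2\<close> over \<open>s\<close>.\<close>

lemma measurable_eigenvector_score:
  "(\<lambda>(a, x). eigenvector_score d a x) \<in> borel_measurable (mat_borel d \<Otimes>\<^sub>M vec_borel d)"
proof (rule borel_measurableI_less)
  fix y :: ennreal
  let ?N = "mat_borel d \<Otimes>\<^sub>M vec_borel d" and ?K = "sphere_coords d"
  \<comment> \<open>A zero of \<open>h s (a, x)\<close> is a unit eigenvector \<open>u\<close> of \<open>a\<close> with \<open>(u \<bullet> x)\<^sup>2 \<le> s\<close>.\<close>
  define h where "h s z f = eigen_residual d (fst z) f + max 0 ((\<Sum>i<d. f i * snd z $ i)\<^sup>2 - s)"
    for s :: real and z f
  define R where "R = {s \<in> \<rat>. 0 \<le> s \<and> ennreal s < y}"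
  have h0: "h s (a, x) f = 0 \<longleftrightarrow> vec d f \<in> unit_eigenvectors d a \<and> (vec d f \<bullet> x)\<^sup>2 \<le> s"
    if "a \<in> carrier_mat d d" "x \<in> carrier_vec d" "f \<in> ?K" for s a x f
  proof -
    have "0 \<le> eigen_residual d a f"
      by (auto simp: eigen_residual_def intro: sum_nonneg)
    then have "h s (a, x) f = 0 \<longleftrightarrow> eigen_residual d a f = 0 \<and> max 0 ((\<Sum>i<d. f i * x $ i)\<^sup>2 - s) = 0"
      unfolding h_def fst_conv snd_conv by (intro add_nonneg_eq_0_iff) auto
    moreover have "vec d f \<bullet> x = (\<Sum>i<d. f i * x $ i)"
      using that(2) by (simp add: scalar_prod_eq_sum)
    ultimately show ?thesis
      using eigen_residual_eq_0_iff[OF that(1,3)] by (auto simp: max_def)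
  qed
  have eq: "{z \<in> space ?N. (case z of (a, x) \<Rightarrow> eigenvector_score d a x) < y}
      = (\<Union>s\<in>R. {z \<in> space ?N. \<exists>f\<in>?K. h s z f = 0})"
  proof -
    have iff: "eigenvector_score d a x < y \<longleftrightarrow> (\<exists>s\<in>R. \<exists>f\<in>?K. h s (a, x) f = 0)"
      if a: "a \<in> carrier_mat d d" and x: "x \<in> carrier_vec d" for a x
    proof
      assume "eigenvector_score d a x < y"
      then obtain u where u: "u \<in> unit_eigenvectors d a" and uy: "ennreal ((u \<bullet> x)\<^sup>2) < y"
        unfolding eigenvector_score_def INF_less_iff by blast
      have "u \<in> vec d ` ?K"
        unfolding vec_image_sphere_coords using u by (simp add: unit_eigenvectors_def)
      then obtain f where f: "f \<in> ?K" "u = vec d f"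
        by blast
      have "\<exists>r. (u \<bullet> x)\<^sup>2 < r \<and> ennreal r \<le> y"
      proof (cases y)
        case (real r)
        then show ?thesis using uy by (intro exI[of _ r]) (simp add: ennreal_less_iff)
      next
        case top
        then show ?thesis by (intro exI[of _ "(u \<bullet> x)\<^sup>2 + 1"]) simp
      qed
      then obtain r where r: "(u \<bullet> x)\<^sup>2 < r" "ennreal r \<le> y" by blast
      obtain s where s: "s \<in> \<rat>" "(u \<bullet> x)\<^sup>2 < s" "s < r"
        using Rats_dense_in_real[OF r(1)] by blast
      have "0 \<le> s" using s(2) zero_le_power2[of "u \<bullet> x"] by linarith
      moreover have "ennreal s < y"
        using ennreal_less_iff[THEN iffD2, OF \<open>0 \<le> s\<close> s(3)] r(2) by (rule less_le_trans)
      ultimately have "s \<in> R" using s(1) by (simp add: R_def)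
      moreover have "h s (a, x) f = 0"
        unfolding h0[OF a x f(1)] using u s(2) unfolding f(2) by (intro conjI less_imp_le)
      ultimately show "\<exists>s\<in>R. \<exists>f\<in>?K. h s (a, x) f = 0" using f(1) by blast
    next
      assume "\<exists>s\<in>R. \<exists>f\<in>?K. h s (a, x) f = 0"
      then obtain s f where s: "s \<in> R" and f: "f \<in> ?K" "h s (a, x) f = 0" by blast
      then have u: "vec d f \<in> unit_eigenvectors d a" "(vec d f \<bullet> x)\<^sup>2 \<le> s"
        unfolding h0[OF a x f(1)] by blast+
      have "eigenvector_score d a x \<le> ennreal ((vec d f \<bullet> x)\<^sup>2)"
        unfolding eigenvector_score_def using u(1) by (rule INF_lower)
      also have "\<dots> \<le> ennreal s" using u(2) by (rule ennreal_leI)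
      also have "\<dots> < y" using s by (simp add: R_def)
      finally show "eigenvector_score d a x < y" .
    qed
    show ?thesis
    proof (rule Set.set_eqI)
      fix z
      show "z \<in> {z \<in> space ?N. (case z of (a, x) \<Rightarrow> eigenvector_score d a x) < y}
        \<longleftrightarrow> z \<in> (\<Union>s\<in>R. {z \<in> space ?N. \<exists>f\<in>?K. h s z f = 0})"
        using iff[of "fst z" "snd z"]
        by (cases "fst z \<in> carrier_mat d d \<and> snd z \<in> carrier_vec d") (auto simp add: space_pair_measure split_beta mem_Times_iff)
    qed
  qed
  have "{z \<in> space ?N. \<exists>f\<in>?K. h s z f = 0} \<in> sets ?N" for s
  proof (rule measurable_compact_exists_zero[where h = "h s" and N = ?N, OF compact_sphere_coords])
    show "continuous_on ?K (h s z)" for z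
      unfolding h_def eigen_residual_def
      by (intro continuous_intros continuous_on_subset[OF continuous_on_product_coordinates subset_UNIV])
    show "0 \<le> h s z u" for z u
      by (auto simp: h_def eigen_residual_def intro!: add_nonneg_nonneg sum_nonneg)
    fix u
    have a: "(\<lambda>z. fst z $$ (i, j)) \<in> borel_measurable ?N" if "i < d" "j < d" for i j
      using that by (intro measurable_mat_index[OF measurable_fst])
    have x: "(\<lambda>z. snd z $ i) \<in> borel_measurable ?N" if "i < d" for i
      using that by (intro measurable_vec_index[OF measurable_snd])
    show "(\<lambda>z. h s z u) \<in> borel_measurable ?N"
      unfolding h_def eigen_residual_def
      by (intro borel_measurable_add borel_measurable_sum borel_measurable_power borel_measurable_diff
          borel_measurable_times borel_measurable_max borel_measurable_const a x) auto
  qed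
  moreover have "countable R"
    unfolding R_def by (rule countable_subset[OF _ countable_rat]) auto
  ultimately show "{z \<in> space ?N. (case z of (a, x) \<Rightarrow> eigenvector_score d a x) < y} \<in> sets ?N"
    unfolding eq by (intro sets.countable_UN') auto
qed

section \<open>Averaging over the ensemble\<close>

text \<open>Independence says that the joint distribution of \<open>X\<close> and \<open>Y\<close> is the product of the marginals, so
  \<open>X\<close> and \<open>Y\<close> may be evaluated at two independent sample points.\<close>

lemma indep_rv_nn_integral:
  assumes M: "prob_space M" and indep: "indep_rv M S X T Y"
    and f: "(\<lambda>(x, y). f x y) \<in> borel_measurable (S \<Otimes>\<^sub>M T)"
  shows "(\<integral>\<^sup>+ \<omega>. f (X \<omega>) (Y \<omega>) \<partial>M) = (\<integral>\<^sup>+ \<omega>'. \<integral>\<^sup>+ \<omega>. f (X \<omega>) (Y \<omega>') \<partial>M \<partial>M)"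
proof -
  interpret prob_space M by (rule M)
  have X: "X \<in> measurable M S" and Y: "Y \<in> measurable M T"
    and ind: "indep_set (sets (vimage_algebra (space M) X S)) (sets (vimage_algebra (space M) Y T))"
    using indep by (auto simp: indep_rv_def)
  interpret DX: prob_space "distr M S X" by (rule prob_space_distr[OF X])
  interpret DY: prob_space "distr M T Y" by (rule prob_space_distr[OF Y])
  interpret pair_sigma_finite "distr M S X" "distr M T Y" ..
  have XY: "(\<lambda>\<omega>. (X \<omega>, Y \<omega>)) \<in> measurable M (S \<Otimes>\<^sub>M T)"
    using X Y by (rule measurable_Pair)
  have f': "(\<lambda>(x, y). f x y) \<in> borel_measurable (distr M S X \<Otimes>\<^sub>M distr M T Y)"
    using f by (simp cong: measurable_cong_sets)
  have joint: "distr M S X \<Otimes>\<^sub>M distr M T Y = distr M (S \<Otimes>\<^sub>M T) (\<lambda>\<omega>. (X \<omega>, Y \<omega>))"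
  proof (rule pair_measure_eqI)
    fix B C assume "B \<in> sets (distr M S X)" "C \<in> sets (distr M T Y)"
    then have B: "B \<in> sets S" and C: "C \<in> sets T" by auto
    have "prob ((X -` B \<inter> space M) \<inter> (Y -` C \<inter> space M))
        = prob (X -` B \<inter> space M) * prob (Y -` C \<inter> space M)"
      using B C by (intro indep_setD[OF ind] in_vimage_algebra)
    moreover have "(\<lambda>\<omega>. (X \<omega>, Y \<omega>)) -` (B \<times> C) \<inter> space M
        = (X -` B \<inter> space M) \<inter> (Y -` C \<inter> space M)"
      by auto
    ultimately show "emeasure (distr M S X) B * emeasure (distr M T Y) C
        = emeasure (distr M (S \<Otimes>\<^sub>M T) (\<lambda>\<omega>. (X \<omega>, Y \<omega>))) (B \<times> C)"
      using B C X Y XY by (simp add: emeasure_distr emeasure_eq_measure ennreal_mult')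
  qed (auto intro: DX.sigma_finite_measure_axioms DY.sigma_finite_measure_axioms)
  have "(\<integral>\<^sup>+ \<omega>. f (X \<omega>) (Y \<omega>) \<partial>M)
      = (\<integral>\<^sup>+ z. (\<lambda>(x, y). f x y) z \<partial>distr M (S \<Otimes>\<^sub>M T) (\<lambda>\<omega>. (X \<omega>, Y \<omega>)))"
    using f by (subst nn_integral_distr[OF XY]) auto
  also have "\<dots> = (\<integral>\<^sup>+ y. \<integral>\<^sup>+ x. f x y \<partial>distr M S X \<partial>distr M T Y)"
    unfolding joint[symmetric] using nn_integral_snd[OF f'] by simp
  also have "\<dots> = (\<integral>\<^sup>+ \<omega>'. \<integral>\<^sup>+ x. f x (Y \<omega>') \<partial>distr M S X \<partial>M)"
  proof (rule nn_integral_distr[OF Y], unfold measurable_distr_eq1)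
    have "(\<lambda>(y, x). f x y) \<in> borel_measurable (distr M T Y \<Otimes>\<^sub>M distr M S X)"
      using measurable_pair_swap[OF f'] by (simp add: split_beta')
    from DX.borel_measurable_nn_integral[OF this]
    show "(\<lambda>y. \<integral>\<^sup>+ x. f x y \<partial>distr M S X) \<in> borel_measurable T"
      by (simp cong: measurable_cong_sets)
  qed
  also have "\<dots> = (\<integral>\<^sup>+ \<omega>'. \<integral>\<^sup>+ \<omega>. f (X \<omega>) (Y \<omega>') \<partial>M \<partial>M)"
  proof (rule nn_integral_cong)
    fix \<omega>' assume "\<omega>' \<in> space M"
    then have y: "Y \<omega>' \<in> space T" using measurable_space[OF Y] by auto
    have "(\<lambda>x. f x (Y \<omega>')) \<in> borel_measurable S"
      using measurable_compose[OF measurable_Pair[OF measurable_ident_sets[OF refl] measurable_const[OF y]] f]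
      by simp
    then show "(\<integral>\<^sup>+ x. f x (Y \<omega>') \<partial>distr M S X) = (\<integral>\<^sup>+ \<omega>. f (X \<omega>) (Y \<omega>') \<partial>M)"
      by (intro nn_integral_distr[OF X]) simp
  qed
  finally show ?thesis .
qed

definition expected_score :: "nat \<Rightarrow> 'w measure \<Rightarrow> ('w \<Rightarrow> real mat) \<Rightarrow> real vec \<Rightarrow> ennreal" where
  "expected_score d M A y = (\<integral>\<^sup>+ \<omega>. eigenvector_score d (A \<omega>) y \<partial>M)"

lemma measurable_eigenvector_score_mat:
  assumes y: "y \<in> carrier_vec d"
  shows "(\<lambda>a. eigenvector_score d a y) \<in> borel_measurable (mat_borel d)"
proof -
  have "y \<in> space (vec_borel d)" using y by simp
  from measurable_compose[OF measurable_Pair[OF measurable_ident_sets[OF refl] measurable_const[OF this]]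
      measurable_eigenvector_score]
  show ?thesis by simp
qed

lemma expected_score_orthogonal_le:
  assumes A: "invariant_symmetric_ensemble d M A" and T: "T \<in> orthogonal_group d"
    and y: "y \<in> carrier_vec d"
  shows "expected_score d M A (T *\<^sub>v y) \<le> expected_score d M A y"
proof -
  have Am: "A \<in> measurable M (mat_borel d)"
    and inv: "distr M (mat_borel d) (\<lambda>\<omega>. T * A \<omega> * T\<^sup>T) = distr M (mat_borel d) A"
    using A T by (auto simp: invariant_symmetric_ensemble_def)
  note TC = orthogonal_groupD(1,2)[OF T]
  have TAm: "(\<lambda>\<omega>. T * A \<omega> * T\<^sup>T) \<in> measurable M (mat_borel d)"
    using TC by (intro measurable_mult_mat Am measurable_const) auto
  have Ty: "T *\<^sub>v y \<in> carrier_vec d" using TC y by simp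
  note Wm = measurable_eigenvector_score_mat[OF Ty]
  have "expected_score d M A (T *\<^sub>v y) = (\<integral>\<^sup>+ a. eigenvector_score d a (T *\<^sub>v y) \<partial>distr M (mat_borel d) A)"
    unfolding expected_score_def using Wm by (intro nn_integral_distr[OF Am, symmetric]) simp
  also have "\<dots> = (\<integral>\<^sup>+ \<omega>. eigenvector_score d (T * A \<omega> * T\<^sup>T) (T *\<^sub>v y) \<partial>M)"
    unfolding inv[symmetric] using Wm by (intro nn_integral_distr[OF TAm]) simp
  also have "\<dots> \<le> expected_score d M A y"
    unfolding expected_score_def
    by (intro nn_integral_mono eigenvector_score_orthogonal_le T y measurable_mat_carrier[OF Am])
  finally show ?thesis .
qed

lemma expected_score_smult_le:
  assumes A: "A \<in> measurable M (mat_borel d)" and s: "s > 0" and y: "y \<in> carrier_vec d"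
  shows "expected_score d M A (s \<cdot>\<^sub>v y) \<le> ennreal (s\<^sup>2) * expected_score d M A y"
proof -
  have "expected_score d M A (s \<cdot>\<^sub>v y) \<le> (\<integral>\<^sup>+ \<omega>. ennreal (s\<^sup>2) * eigenvector_score d (A \<omega>) y \<partial>M)"
    unfolding expected_score_def by (intro nn_integral_mono eigenvector_score_smult_le s y)
  also have "\<dots> = ennreal (s\<^sup>2) * expected_score d M A y"
    unfolding expected_score_def
    by (intro nn_integral_cmult measurable_compose[OF A] measurable_eigenvector_score_mat y)
  finally show ?thesis .
qed

text \<open>Some orthogonal map sends \<open>x\<close>, rescaled to the norm of \<open>y\<close>, to \<open>y\<close>. Exchanging \<open>x\<close> and \<open>y\<close> gives the reverse
  inequality for nonzero vectors, so the expected score is a multiple of the squared norm.\<close>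

lemma expected_score_homogeneous:
  assumes A: "invariant_symmetric_ensemble d M A"
    and x: "x \<in> carrier_vec d" and y: "y \<in> carrier_vec d" and y0: "y \<bullet> y \<noteq> 0"
  shows "ennreal (x \<bullet> x) * expected_score d M A y \<le> ennreal (y \<bullet> y) * expected_score d M A x"
proof (cases "x \<bullet> x = 0")
  case True
  then show ?thesis by simp
next
  case False
  have Am: "A \<in> measurable M (mat_borel d)"
    using A by (simp add: invariant_symmetric_ensemble_def)
  have pos: "x \<bullet> x > 0" "y \<bullet> y > 0"
    using False y0 scalar_prod_self_nonneg[of x] scalar_prod_self_nonneg[of y] by auto
  define s where "s = sqrt ((y \<bullet> y) / (x \<bullet> x))"
  have s: "s > 0" "s\<^sup>2 = (y \<bullet> y) / (x \<bullet> x)"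
    using pos by (simp_all add: s_def)
  have sx: "s \<cdot>\<^sub>v x \<in> carrier_vec d" using x by simp
  have "(s \<cdot>\<^sub>v x) \<bullet> (s \<cdot>\<^sub>v x) = s\<^sup>2 * (x \<bullet> x)"
    using x by (simp add: power2_eq_square)
  also have "\<dots> = y \<bullet> y" using pos by (simp add: s(2))
  finally obtain T where T: "T \<in> orthogonal_group d" "T *\<^sub>v (s \<cdot>\<^sub>v x) = y"
    using orthogonal_group_transitive[OF sx y] by blast
  have "expected_score d M A y \<le> expected_score d M A (s \<cdot>\<^sub>v x)"
    using expected_score_orthogonal_le[OF A T(1) sx] unfolding T(2) .
  also have "\<dots> \<le> ennreal (s\<^sup>2) * expected_score d M A x"
    by (rule expected_score_smult_le[OF Am s(1) x])
  finally have "ennreal (x \<bullet> x) * expected_score d M A y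
      \<le> ennreal (x \<bullet> x) * (ennreal (s\<^sup>2) * expected_score d M A x)"
    by (rule mult_left_mono) simp
  also have "\<dots> = ennreal ((x \<bullet> x) * s\<^sup>2) * expected_score d M A x"
    using pos by (simp only: ennreal_mult' less_imp_le mult.assoc)
  also have "(x \<bullet> x) * s\<^sup>2 = y \<bullet> y" using pos by (simp add: s(2))
  finally show ?thesis .
qed

text \<open>In the eigenbasis the score is bounded by the least squared coordinate of \<open>Q' x\<close>, and \<open>Q' x\<close> is
  again a standard Gaussian vector.\<close>

lemma gauss_eigenvector_score_le:
  assumes a: "a \<in> carrier_mat d d" and sym: "a\<^sup>T = a" and card: "card (spectrum a) = d" and d: "d \<ge> 1"
  shows "(\<integral>\<^sup>+ x. eigenvector_score d a x * gauss_density d x \<partial>vec_lborel d) \<le> ennreal (pi / (real d)\<^sup>2)"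
proof -
  obtain Q where Q: "orthogonally_diagonalizes Q a"
    using orthogonally_diagonalizes_exists[OF a sym card d] by blast
  have QT: "Q\<^sup>T \<in> orthogonal_group d"
    by (rule orthogonal_group_transpose[OF unit_eigenvectors_diagonalized(1)[OF a card Q]])
  let ?m = "\<lambda>x. ennreal ((MIN i\<in>{..<d}. \<bar>x $ i\<bar>)\<^sup>2) * gauss_density d x"
  have ne: "{..<d} \<noteq> {}" using d by (simp add: lessThan_empty_iff)
  have "(\<lambda>x. MIN i\<in>{..<d}. \<bar>x $ i\<bar>) \<in> borel_measurable (vec_borel d)"
    using ne by (intro borel_measurable_Min borel_measurable_abs measurable_vec_index[of _ _ d]) auto
  then have mm: "?m \<in> borel_measurable (vec_borel d)"
    by (intro borel_measurable_times_ennreal measurable_gauss_density measurable_compose[OF _ measurable_ennreal]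
        borel_measurable_power)
  have "(\<integral>\<^sup>+ x. eigenvector_score d a x * gauss_density d x \<partial>vec_lborel d) \<le> (\<integral>\<^sup>+ x. ?m (Q\<^sup>T *\<^sub>v x) \<partial>vec_lborel d)"
  proof (rule nn_integral_mono)
    fix x assume "x \<in> space (vec_lborel d)"
    then have x: "x \<in> carrier_vec d" by simp
    show "eigenvector_score d a x * gauss_density d x \<le> ?m (Q\<^sup>T *\<^sub>v x)"
      unfolding gauss_density_orthogonal[OF QT x]
      by (intro mult_right_mono eigenvector_score_le_min[OF a card Q d x]) simp
  qed
  also have "\<dots> = (\<integral>\<^sup>+ x. ?m x \<partial>vec_lborel d)"
    by (rule vec_lborel_orthogonal[OF QT mm])
  also have "\<dots> \<le> ennreal (pi / (real d)\<^sup>2)"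
    by (rule gauss_min_square[OF d])
  finally show ?thesis .
qed

text \<open>Integrate \<open>|x|\<^sup>2 F(y) \<le> |y|\<^sup>2 F(x)\<close> over a standard Gaussian \<open>x\<close>. The left-hand side becomes
  \<open>d F(y)\<close>. On the right-hand side, exchanging the expectation over \<open>A\<close> with the Gaussian integral
  leaves at most \<open>|y|\<^sup>2 \<pi>/d\<^sup>2\<close>.\<close>

lemma expected_score_le:
  assumes M: "prob_space M" and A: "invariant_symmetric_ensemble d M A"
    and d: "d \<ge> 1" and y: "y \<in> carrier_vec d"
  shows "expected_score d M A y \<le> ennreal (pi / real d ^ 3) * ennreal (y \<bullet> y)"
proof -
  interpret MP: prob_space M by (rule M)
  interpret L: sigma_finite_measure "vec_lborel d" by (rule sigma_finite_vec_lborel)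
  interpret pair_sigma_finite "vec_lborel d" M ..
  have Am: "A \<in> measurable M (mat_borel d)"
    and sym: "AE \<omega> in M. (A \<omega>)\<^sup>T = A \<omega>" and card: "AE \<omega> in M. card (spectrum (A \<omega>)) = d"
    using A by (auto simp: invariant_symmetric_ensemble_def)
  show ?thesis
  proof (cases "y \<bullet> y = 0")
    case True
    then have y0: "y = 0\<^sub>v d" by (rule scalar_prod_self_eq_0[OF y])
    \<comment> \<open>No rescaling reaches the zero vector; there the score vanishes whenever an eigenbasis exists.\<close>
    have "expected_score d M A y \<le> (\<integral>\<^sup>+ \<omega>. 0 \<partial>M)"
      unfolding expected_score_def
    proof (rule nn_integral_mono_AE)
      show "AE \<omega> in M. eigenvector_score d (A \<omega>) y \<le> 0"
        using sym card AE_space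
      proof eventually_elim
        case (elim \<omega>)
        have a: "A \<omega> \<in> carrier_mat d d" by (rule measurable_mat_carrier[OF Am elim(3)])
        obtain Q where Q: "orthogonally_diagonalizes Q (A \<omega>)"
          using orthogonally_diagonalizes_exists[OF a elim(1,2) d] by blast
        have Qc: "Q\<^sup>T \<in> carrier_mat d d"
          using orthogonal_groupD(2)[OF unit_eigenvectors_diagonalized(1)[OF a elim(2) Q]] .
        have "(\<lambda>i. \<bar>(Q\<^sup>T *\<^sub>v y) $ i\<bar>) ` {..<d} = (\<lambda>i. 0) ` {..<d}"
          using Qc y0 by (intro image_cong) (auto simp: mult_mat_vec_index[OF Qc zero_carrier_vec] simp del: index_mult_mat_vec)
        also have "\<dots> = {0}"
          using d by (simp add: image_constant_conv lessThan_empty_iff)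
        finally show ?case
          using eigenvector_score_le_min[OF a elim(2) Q d y] by simp
      qed
    qed
    then show ?thesis by simp
  next
    case False
    let ?g = "gauss_density d" and ?F = "expected_score d M A" and ?W = "eigenvector_score d"
    have swap: "(\<lambda>z. (A (snd z), fst z)) \<in> measurable (vec_lborel d \<Otimes>\<^sub>M M) (mat_borel d \<Otimes>\<^sub>M vec_borel d)"
    proof (rule measurable_Pair)
      show "fst \<in> measurable (vec_lborel d \<Otimes>\<^sub>M M) (vec_borel d)"
        using measurable_fst[of "vec_lborel d" M] by (simp cong: measurable_cong_sets)
    qed (rule measurable_compose[OF measurable_snd Am])
    have Wm: "(\<lambda>(x, \<omega>). ?W (A \<omega>) x) \<in> borel_measurable (vec_lborel d \<Otimes>\<^sub>M M)"
      using measurable_compose[OF swap measurable_eigenvector_score] by (simp add: split_beta')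
    have gm: "(\<lambda>z. ?g (fst z)) \<in> borel_measurable (vec_lborel d \<Otimes>\<^sub>M M)"
      by (rule measurable_compose[OF measurable_fst]) simp
    have Wgm: "(\<lambda>(x, \<omega>). ?W (A \<omega>) x * ?g x) \<in> borel_measurable (vec_lborel d \<Otimes>\<^sub>M M)"
      using borel_measurable_times_ennreal[OF Wm gm] by (simp add: split_beta')
    have Fm: "?F \<in> borel_measurable (vec_lborel d)"
      unfolding expected_score_def by (rule MP.borel_measurable_nn_integral[OF Wm])
    have "of_nat d * ?F y = (\<integral>\<^sup>+ x. ennreal (x \<bullet> x) * ?g x \<partial>vec_lborel d) * ?F y"
      by (simp only: gauss_second_moment)
    also have "\<dots> = (\<integral>\<^sup>+ x. ennreal (x \<bullet> x) * ?g x * ?F y \<partial>vec_lborel d)"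
      by (rule nn_integral_multc[symmetric]) (auto intro!: measurable_scalar_prod)
    also have "\<dots> \<le> (\<integral>\<^sup>+ x. ennreal (y \<bullet> y) * (?F x * ?g x) \<partial>vec_lborel d)"
    proof (rule nn_integral_mono)
      fix x assume "x \<in> space (vec_lborel d)"
      then have x: "x \<in> carrier_vec d" by simp
      have "(ennreal (x \<bullet> x) * ?F y) * ?g x \<le> (ennreal (y \<bullet> y) * ?F x) * ?g x"
        by (intro mult_right_mono expected_score_homogeneous[OF A x y False]) simp
      then show "ennreal (x \<bullet> x) * ?g x * ?F y \<le> ennreal (y \<bullet> y) * (?F x * ?g x)"
        by (simp only: mult_ac)
    qed
    also have "\<dots> = ennreal (y \<bullet> y) * (\<integral>\<^sup>+ x. ?F x * ?g x \<partial>vec_lborel d)"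
      by (rule nn_integral_cmult) (intro borel_measurable_times_ennreal Fm, simp)
    also have "(\<integral>\<^sup>+ x. ?F x * ?g x \<partial>vec_lborel d) = (\<integral>\<^sup>+ x. \<integral>\<^sup>+ \<omega>. ?W (A \<omega>) x * ?g x \<partial>M \<partial>vec_lborel d)"
      unfolding expected_score_def
      by (intro nn_integral_cong nn_integral_multc[symmetric] measurable_compose[OF Am]
          measurable_eigenvector_score_mat) simp
    also have "\<dots> = (\<integral>\<^sup>+ \<omega>. \<integral>\<^sup>+ x. ?W (A \<omega>) x * ?g x \<partial>vec_lborel d \<partial>M)"
      by (rule Fubini'[OF Wgm, symmetric])
    also have "\<dots> \<le> (\<integral>\<^sup>+ \<omega>. ennreal (pi / (real d)\<^sup>2) \<partial>M)"
    proof (rule nn_integral_mono_AE)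
      show "AE \<omega> in M. (\<integral>\<^sup>+ x. ?W (A \<omega>) x * ?g x \<partial>vec_lborel d) \<le> ennreal (pi / (real d)\<^sup>2)"
        using sym card AE_space
        by eventually_elim (rule gauss_eigenvector_score_le[OF measurable_mat_carrier[OF Am] _ _ d])
    qed
    also have "\<dots> = ennreal (pi / (real d)\<^sup>2)"
      by (simp add: MP.emeasure_space_1)
    finally have *: "of_nat d * ?F y \<le> ennreal (y \<bullet> y) * ennreal (pi / (real d)\<^sup>2)"
      by (simp add: mult_left_mono)
    have "?F y = ennreal (1 / real d) * (of_nat d * ?F y)"
    proof -
      have "ennreal (1 / real d) * of_nat d = 1"
        using d by (simp add: ennreal_of_nat_eq_real_of_nat ennreal_mult'[symmetric])
      then show ?thesis by (simp flip: mult.assoc)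
    qed
    also have "\<dots> \<le> ennreal (1 / real d) * (ennreal (y \<bullet> y) * ennreal (pi / (real d)\<^sup>2))"
      using * by (rule mult_left_mono) simp
    also have "\<dots> = ennreal (pi / real d ^ 3) * ennreal (y \<bullet> y)"
      using scalar_prod_self_nonneg[of y]
      by (simp add: ennreal_mult'[symmetric] power2_eq_square power3_eq_cube mult_ac)
    finally show ?thesis .
  qed
qed

text \<open>The quantitative form of the theorem, valid in every dimension.\<close>

lemma icis_second_moment_le:
  assumes M: "prob_space M" and A: "invariant_symmetric_ensemble d M A"
    and indep: "indep_rv M (mat_borel d) A (vec_borel d) x0" and d: "d \<ge> 1"
  shows "(\<integral>\<^sup>+ \<omega>. ennreal ((icis (A \<omega>) (x0 \<omega>))\<^sup>2) \<partial>M)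
    \<le> ennreal pi * ((\<integral>\<^sup>+ \<omega>. ennreal ((vec_norm2 (x0 \<omega>))\<^sup>2) \<partial>M) / ennreal (real d ^ 3))"
proof -
  have Am: "A \<in> measurable M (mat_borel d)" and xm: "x0 \<in> measurable M (vec_borel d)"
    and sym: "AE \<omega> in M. (A \<omega>)\<^sup>T = A \<omega>" and card: "AE \<omega> in M. card (spectrum (A \<omega>)) = d"
    using A indep by (auto simp: invariant_symmetric_ensemble_def indep_rv_def)
  have norm: "(vec_norm2 (x0 \<omega>))\<^sup>2 = x0 \<omega> \<bullet> x0 \<omega>" if "\<omega> \<in> space M" for \<omega>
    using measurable_vec_carrier[OF xm that]
    by (simp add: vec_norm2_def L2_set_def sum_nonneg scalar_prod_eq_sum[of _ d] power2_eq_square)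
  have "(\<integral>\<^sup>+ \<omega>. ennreal ((icis (A \<omega>) (x0 \<omega>))\<^sup>2) \<partial>M) \<le> (\<integral>\<^sup>+ \<omega>. eigenvector_score d (A \<omega>) (x0 \<omega>) \<partial>M)"
  proof (rule nn_integral_mono_AE)
    show "AE \<omega> in M. ennreal ((icis (A \<omega>) (x0 \<omega>))\<^sup>2) \<le> eigenvector_score d (A \<omega>) (x0 \<omega>)"
      using sym card AE_space
      by eventually_elim
        (rule icis_le_eigenvector_score[OF measurable_mat_carrier[OF Am] _ _ d measurable_vec_carrier[OF xm]])
  qed
  also have "\<dots> = (\<integral>\<^sup>+ \<omega>'. expected_score d M A (x0 \<omega>') \<partial>M)"
    unfolding expected_score_def by (rule indep_rv_nn_integral[OF M indep measurable_eigenvector_score])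
  also have "\<dots> \<le> (\<integral>\<^sup>+ \<omega>. ennreal (pi / real d ^ 3) * ennreal (x0 \<omega> \<bullet> x0 \<omega>) \<partial>M)"
    by (intro nn_integral_mono expected_score_le M A d measurable_vec_carrier[OF xm])
  also have "\<dots> = ennreal (pi / real d ^ 3) * (\<integral>\<^sup>+ \<omega>. ennreal (x0 \<omega> \<bullet> x0 \<omega>) \<partial>M)"
    by (intro nn_integral_cmult measurable_compose[OF _ measurable_ennreal] measurable_scalar_prod[OF xm xm])
  also have "(\<integral>\<^sup>+ \<omega>. ennreal (x0 \<omega> \<bullet> x0 \<omega>) \<partial>M) = (\<integral>\<^sup>+ \<omega>. ennreal ((vec_norm2 (x0 \<omega>))\<^sup>2) \<partial>M)"
    by (intro nn_integral_cong) (simp only: norm)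
  also have "ennreal (pi / real d ^ 3) = ennreal pi / ennreal (real d ^ 3)"
    using d by (intro divide_ennreal[symmetric]) auto
  finally show ?thesis
    by (simp add: ennreal_times_divide ennreal_divide_times mult.commute)
qed

theorem theorem3p1:
  fixes M :: "nat \<Rightarrow> 'w measure"
    and A :: "nat \<Rightarrow> 'w \<Rightarrow> real mat"
    and x0 :: "nat \<Rightarrow> 'w \<Rightarrow> real vec"
  assumes "\<And>d. d \<ge> 1 \<Longrightarrow> prob_space (M d)"
    and "\<And>d. d \<ge> 1 \<Longrightarrow> invariant_symmetric_ensemble d (M d) (A d)"
    and "\<And>d. d \<ge> 1 \<Longrightarrow> indep_rv (M d) (mat_borel d) (A d) (vec_borel d) (x0 d)"
    and "((\<lambda>d. (\<integral>\<^sup>+ \<omega>. ennreal ((vec_norm2 (x0 d \<omega>))\<^sup>2) \<partial>M d) / ennreal (real d ^ 3))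
            \<longlongrightarrow> 0) sequentially"
  shows "((\<lambda>d. \<integral>\<^sup>+ \<omega>. ennreal ((icis (A d \<omega>) (x0 d \<omega>))\<^sup>2) \<partial>M d) \<longlongrightarrow> 0) sequentially"
proof (rule tendsto_sandwich[where f = "\<lambda>_. 0"])
  show "\<forall>\<^sub>F d in sequentially. (\<integral>\<^sup>+ \<omega>. ennreal ((icis (A d \<omega>) (x0 d \<omega>))\<^sup>2) \<partial>M d)
      \<le> ennreal pi * ((\<integral>\<^sup>+ \<omega>. ennreal ((vec_norm2 (x0 d \<omega>))\<^sup>2) \<partial>M d) / ennreal (real d ^ 3))"
    using eventually_ge_at_top[of 1] by eventually_elim (intro icis_second_moment_le assms)
  show "((\<lambda>d. ennreal pi * ((\<integral>\<^sup>+ \<omega>. ennreal ((vec_norm2 (x0 d \<omega>))\<^sup>2) \<partial>M d) / ennreal (real d ^ 3)))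
      \<longlongrightarrow> 0) sequentially"
    using ennreal_tendsto_cmult[OF _ assms(4), of "ennreal pi"] by simp
  show "\<forall>\<^sub>F d in sequentially. 0 \<le> (\<integral>\<^sup>+ \<omega>. ennreal ((icis (A d \<omega>) (x0 d \<omega>))\<^sup>2) \<partial>M d)"
    by simp
qed (rule tendsto_const)

end
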